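(* Let $I=\langle h_1,\ldots,h_m\rangle\subseteq\mathbb{R}[x]$. Then $$V_{\mathbb{R}}(I)=\emptyset\iff K_t^{\mathbb{R}}=\emptyset\ \text{ for some integer } t\ge d.$$
   Context: $\mathbb{R}[x]=\mathbb{R}[x_1,\ldots,x_n]$; $V_{\mathbb{R}}(I)$ is the set of real common zeros of $I$. For $\alpha\in\mathbb{N}^n$, $|\alpha|=\sum_i\alpha_i$; $\mathbb{N}^n_t=\{\alpha:|\alpha|\le t\}$. Set $d_j:=\lceil\deg(h_j)/2\rceil$ and $d:=\max_{j=1,\ldots,m}d_j$. For $y\in\mathbb{R}^{\mathbb{N}^n_{2t}}$ and $0\le s\le t$, $M_s^{\mathbb{R}}(y)$ is the matrix indexed by $\mathbb{N}^n_s$ with $(\alpha,\beta)$ entry $y_{\alpha+\beta}$. For $h=\sum_\beta h_\beta x^\beta$, $(hy)_\alpha=\sum_\beta h_\beta y_{\alpha+\beta}$. For $t\ge d$, $$K_t^{\mathbb{R}}:=\{y\in\mathbb{R}^{\mathbb{N}^n_{2t}} : y_0=1,\ M_t^{\mathbb{R}}(y)\succeq 0,\ M_{t-d_j}^{\mathbb{R}}(h_jy)=0\ (j=1,\ldots,m)\}.$$ *)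

theory Defs
  imports "HOL-Analysis.Analysis" "HOL-Library.Poly_Mapping"
begin

text \<open>
  The number of variables is the cardinality of the finite index type \<open>'n\<close>, so every function
  \<open>'n \<Rightarrow> nat\<close> is finitely supported and \<open>'n monom\<close> is all of $\mathbb{N}^n$.  The ring structure of
  \<open>'n rpoly\<close> is the convolution product of \<open>Poly_Mapping\<close>.
\<close>

type_synonym 'n monom = "'n \<Rightarrow>\<^sub>0 nat"
type_synonym 'n rpoly = "'n monom \<Rightarrow>\<^sub>0 real"

definition monom_deg :: "'n::finite monom \<Rightarrow> nat" where
  "monom_deg \<alpha> = (\<Sum>i\<in>UNIV. Poly_Mapping.lookup \<alpha> i)"

definition monoms_upto :: "nat \<Rightarrow> 'n::finite monom set" where
  "monoms_upto t = {\<alpha>. monom_deg \<alpha> \<le> t}"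

text \<open>Finiteness ensures that sums over \<open>monoms_upto t\<close> are not 0 by default.\<close>

lemma finite_monoms_upto: "finite (monoms_upto t :: 'n::finite monom set)"
proof (rule inj_on_finite)
  have le: "Poly_Mapping.lookup \<alpha> i \<le> t" if "\<alpha> \<in> monoms_upto t" for \<alpha> :: "'n monom" and i
  proof -
    have "Poly_Mapping.lookup \<alpha> i \<le> monom_deg \<alpha>"
      unfolding monom_deg_def by (rule member_le_sum) auto
    then show ?thesis using that by (simp add: monoms_upto_def)
  qed
  show "inj_on Poly_Mapping.lookup (monoms_upto t :: 'n monom set)"
    by (rule inj_onI) (rule poly_mapping_eqI, simp)
  show "Poly_Mapping.lookup ` (monoms_upto t :: 'n monom set) \<subseteq> UNIV \<rightarrow>\<^sub>E {..t}"
    by (auto simp: PiE_def le)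
  show "finite ((UNIV :: 'n set) \<rightarrow>\<^sub>E {..t})"
    by (rule finite_PiE) auto
qed

text \<open>The zero polynomial gets degree 0.\<close>

definition total_deg :: "'n::finite rpoly \<Rightarrow> nat" where
  "total_deg f = Max (insert 0 (monom_deg ` Poly_Mapping.keys f))"

definition poly_eval :: "'n::finite rpoly \<Rightarrow> real ^ 'n \<Rightarrow> real" where
  "poly_eval f x = (\<Sum>\<alpha>\<in>Poly_Mapping.keys f. Poly_Mapping.lookup f \<alpha> *
    (\<Prod>i\<in>UNIV. (x $ i) ^ Poly_Mapping.lookup \<alpha> i))"

definition gen_ideal :: "nat \<Rightarrow> (nat \<Rightarrow> 'n::finite rpoly) \<Rightarrow> 'n rpoly set" where
  "gen_ideal m h = {\<Sum>j=1..m. q j * h j | q. True}"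

definition real_variety :: "'n::finite rpoly set \<Rightarrow> (real ^ 'n) set" where
  "real_variety I = {x. \<forall>f\<in>I. poly_eval f x = 0}"

definition half_deg :: "'n::finite rpoly \<Rightarrow> nat" where
  "half_deg f = nat \<lceil>real (total_deg f) / 2\<rceil>"

text \<open>The inserted 0 only matters for \<open>m = 0\<close>.\<close>

definition max_half_deg :: "nat \<Rightarrow> (nat \<Rightarrow> 'n::finite rpoly) \<Rightarrow> nat" where
  "max_half_deg m h = Max (insert 0 ((\<lambda>j. half_deg (h j)) ` {1..m}))"

text \<open>
  Matrices with rows and columns indexed by a finite set \<open>A\<close> of exponents are functions of two
  arguments of which only the values on \<open>A \<times> A\<close> count; \<open>moment_mat y\<close> is thus the same
  function for every order $s$, and the order enters through \<open>A = monoms_upto s\<close>.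
\<close>

definition moment_mat ::
    "('n::finite monom \<Rightarrow> real) \<Rightarrow> 'n monom \<Rightarrow> 'n monom \<Rightarrow> real" where
  "moment_mat y \<alpha> \<beta> = y (\<alpha> + \<beta>)"

definition psd_on :: "'a set \<Rightarrow> ('a \<Rightarrow> 'a \<Rightarrow> real) \<Rightarrow> bool" where
  "psd_on A M \<longleftrightarrow> (\<forall>a\<in>A. \<forall>b\<in>A. M a b = M b a) \<and>
     (\<forall>v. 0 \<le> (\<Sum>a\<in>A. \<Sum>b\<in>A. v a * M a b * v b))"

definition zero_on :: "'a set \<Rightarrow> ('a \<Rightarrow> 'a \<Rightarrow> real) \<Rightarrow> bool" where
  "zero_on A M \<longleftrightarrow> (\<forall>a\<in>A. \<forall>b\<in>A. M a b = 0)"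

definition shift_seq ::
    "'n::finite rpoly \<Rightarrow> ('n monom \<Rightarrow> real) \<Rightarrow> 'n monom \<Rightarrow> real" where
  "shift_seq h y \<alpha> = (\<Sum>\<beta>\<in>Poly_Mapping.keys h. Poly_Mapping.lookup h \<beta> * y (\<alpha> + \<beta>))"

text \<open>
  A vector indexed by the exponents of degree at most $2t$ is an extensional function.  When
  $t$ is at least every \<open>half_deg (h j)\<close>, the conditions below only use \<open>y\<close> on
  \<open>monoms_upto (2 * t)\<close>, and the natural number subtraction is not truncated.
\<close>

definition moment_set :: "nat \<Rightarrow> (nat \<Rightarrow> 'n::finite rpoly) \<Rightarrow> nat \<Rightarrow> ('n monom \<Rightarrow> real) set" where
  "moment_set m h t = {y \<in> monoms_upto (2 * t) \<rightarrow>\<^sub>E UNIV.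
     y 0 = 1 \<and>
     psd_on (monoms_upto t) (moment_mat y) \<and>
     (\<forall>j\<in>{1..m}. zero_on (monoms_upto (t - half_deg (h j))) (moment_mat (shift_seq (h j) y)))}"

end

theory Submission
  imports Defs "HOL-Algebra.Algebraic_Closure_Type" "HOL-Computational_Algebra.Fraction_Field"
begin

text \<open>
  A real common zero \<open>x\<close> yields the moment sequence \<open>\<alpha> \<mapsto> x\<^sup>\<alpha>\<close>, which lies in every
  \<open>moment_set\<close> (\<open>point_moment_sequence\<close>).  The converse rests on the real Nullstellensatz: if there
  is no real common zero, then \<open>1 + s\<close> lies in the ideal for some sum of squares \<open>s\<close>.  The linear
  functional attached to a sequence in \<open>moment_set m h t\<close> with \<open>t\<close> large compared to the degrees in
  this certificate would be at least \<open>1\<close> on \<open>1 + s\<close> and vanish on its representation in terms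
  of the generators (\<open>moment_set_eventually_empty\<close>).

  The Nullstellensatz is proved by the method of Artin and Lang.  If \<open>- 1\<close> is not a sum of squares
  modulo the ideal, Zorn's lemma gives an ordering of the polynomial ring whose support, a prime
  ideal, contains the ideal (\<open>ring_cone_extends_to_ordering\<close>).  The quotient by the support is an ordered
  domain; its fraction field embeds into a real closed field, and the classes of the variables
  form a common zero there.  It remains to come down to the real numbers, which is done
  in \<open>signs_realized_over_reals\<close>: the signs that finitely many real polynomials take at a point over
  a real closed field are also taken at some real point.

  This transfer goes by induction on the number of variables, using an argument of Cohen and
  Hoermander for the step.  Polynomials in the last variable have coefficients
  whose signs have already been realized at real points.  The diagram that records how the roots and signs
  of a finite set of univariate polynomials are arranged on the line is determined, one polynomial of maximal
  degree at a time, by the diagram of polynomials of smaller degree: the derivative and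
  remainders of pseudo-division (\<open>same_diagram_insert\<close>, \<open>specializes_insert\<close>).  So both
  fields have the same diagram, and a point of the one line has a counterpart on the other.

  The real closure of an ordered field is obtained inside its algebraic closure, as the field generated
  by a maximal positive cone.  Its intermediate value property (\<open>real_closure_IVT\<close>) comes from the
  argument of Artin and Schreier, applied to a counterexample of minimal degree.
\<close>

hide_const (open) Module.smult Polynomials.degree Polynomials.lead_coeff up_ring.coeff up_ring.monom Coset.order

section \<open>Polynomials over real closed fields\<close>

text \<open>
  Ordered fields with the intermediate value property for polynomials are exactly the real closed
  fields.  Explicit coefficient sums avoid the sort constraint that a
  polynomial over the type being classified would impose.
\<close>

class real_closed_field = linordered_field +
  assumes sum_power_IVT:
    "a < b \<Longrightarrow> (\<Sum>i\<le>n. c i * a ^ i) < 0 \<Longrightarrow> 0 < (\<Sum>i\<le>n. c i * b ^ i)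
      \<Longrightarrow> \<exists>x. a < x \<and> x < b \<and> (\<Sum>i\<le>n. c i * x ^ i) = 0"

lemma rcf_poly_IVT:
  fixes p :: "'a::real_closed_field poly"
  assumes "a < b" "poly p a * poly p b < 0"
  shows "\<exists>x. a < x \<and> x < b \<and> poly p x = 0"
proof -
  have *: "\<exists>x. a < x \<and> x < b \<and> poly q x = 0" if "poly q a < 0" "0 < poly q b" for q :: "'a poly"
    using sum_power_IVT[of a b "coeff q" "degree q"] assms(1) that by (simp add: poly_altdef)
  from assms(2) consider "poly p a < 0" "0 < poly p b" | "poly (-p) a < 0" "0 < poly (-p) b"
    by (auto simp: mult_less_0_iff)
  then show ?thesis using *[of p] *[of "-p"] by cases auto
qed

instance real :: real_closed_field
proof
  fix a b :: real and c n
  assume "a < b" "(\<Sum>i\<le>n. c i * a ^ i) < 0" "0 < (\<Sum>i\<le>n. c i * b ^ i)"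
  moreover have "poly (\<Sum>i\<le>n. monom (c i) i) x = (\<Sum>i\<le>n. c i * x ^ i)" for x
    by (simp add: poly_sum poly_monom)
  ultimately show "\<exists>x>a. x < b \<and> (\<Sum>i\<le>n. c i * x ^ i) = 0"
    using poly_IVT_pos[of a b "\<Sum>i\<le>n. monom (c i) i"] by auto
qed

lemma rcf_no_root_same_sign:
  fixes p :: "'a::real_closed_field poly"
  assumes "a \<le> b" "\<And>x. a \<le> x \<Longrightarrow> x \<le> b \<Longrightarrow> poly p x \<noteq> 0"
  shows "0 < poly p a * poly p b"
proof (cases "a = b")
  case True
  with assms show ?thesis by (auto simp: zero_less_mult_iff linorder_neq_iff)
next
  case False
  with assms(1) have "a < b" by simp
  have "\<not> poly p a * poly p b < 0"
    using rcf_poly_IVT[OF \<open>a < b\<close>, of p] assms(2) by force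
  moreover have "poly p a * poly p b \<noteq> 0"
    using assms by simp
  ultimately show ?thesis by (meson linorder_neqE)
qed

text \<open>
  Without compactness there is no maximum to look at.  Between two neighbouring roots \<open>a\<close> and \<open>b'\<close> write
  $p = (x - a)^{m+1} (x - b')^{k+1} g$ with \<open>g\<close> of constant sign.  The derivative is
  $(x - a)^m (x - b')^k r$, and \<open>r\<close> has opposite signs at \<open>a\<close> and \<open>b'\<close>.
\<close>

lemma rcf_rolle:
  fixes p :: "'a::real_closed_field poly"
  assumes "a < b" "poly p a = 0" "poly p b = 0"
  shows "\<exists>x. a < x \<and> x < b \<and> poly (pderiv p) x = 0"
proof (cases "p = 0")
  case True
  then show ?thesis using dense[OF assms(1)] by simp
next
  case False
  define S where "S = {x. a < x \<and> poly p x = 0}"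
  have S: "finite S" "b \<in> S"
    using poly_roots_finite[OF False] assms by (auto simp: S_def elim: rev_finite_subset)
  define b' where "b' = Min S"
  have b': "a < b'" "b' \<le> b" "poly p b' = 0"
    using Min_in[OF S(1)] Min_le[OF S] S(2) unfolding b'_def[symmetric] by (auto simp: S_def)
  have no_root: "poly p x \<noteq> 0" if "a < x" "x < b'" for x
    using Min_le[OF S(1), of x] that unfolding b'_def[symmetric] by (auto simp: S_def)
  obtain q where q: "p = [:- a, 1:] ^ order a p * q" "\<not> [:- a, 1:] dvd q"
    using order_decomp[OF False] by blast
  have "q \<noteq> 0" using q(2) by auto
  have "poly q a \<noteq> 0" using q(2) by (simp add: poly_eq_0_iff_dvd)
  have "poly q b' = 0" using b' arg_cong[OF q(1), of "\<lambda>p. poly p b'"] by (simp add: poly_power)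
  obtain g where g: "q = [:- b', 1:] ^ order b' q * g" "\<not> [:- b', 1:] dvd g"
    using order_decomp[OF \<open>q \<noteq> 0\<close>] by blast
  have "poly g b' \<noteq> 0" using g(2) by (simp add: poly_eq_0_iff_dvd)
  have "poly g a \<noteq> 0" using \<open>poly q a \<noteq> 0\<close> arg_cong[OF g(1), of "\<lambda>p. poly p a"] by auto
  obtain m where m: "order a p = Suc m"
    using False assms(2) order_root[of p a] by (cases "order a p") auto
  obtain k where k: "order b' q = Suc k"
    using \<open>q \<noteq> 0\<close> \<open>poly q b' = 0\<close> order_root[of q b'] by (cases "order b' q") auto
  let ?A = "[:- a, 1:]" and ?B = "[:- b', 1:]"
  have p: "p = ?A ^ Suc m * (?B ^ Suc k * g)"
    using q(1) g(1) m k by simp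
  have g_no_root: "poly g x \<noteq> 0" if "a \<le> x" "x \<le> b'" for x
  proof (cases "x = a \<or> x = b'")
    case True
    with \<open>poly g a \<noteq> 0\<close> \<open>poly g b' \<noteq> 0\<close> show ?thesis by auto
  next
    case False
    with that no_root[of x] show ?thesis by (auto simp: p)
  qed
  define r where "r = of_nat (Suc m) * (?B * g) + of_nat (Suc k) * (?A * g) + ?A * ?B * pderiv g"
  have power: "pderiv ([:c, 1:] ^ Suc n) = of_nat (Suc n) * [:c, 1:] ^ n" for c :: 'a and n
    unfolding pderiv_power_Suc by (simp add: pderiv_pCons of_nat_poly del: of_nat_Suc)
  have p': "pderiv p = ?A ^ m * ?B ^ k * r"
    unfolding p r_def pderiv_mult power unfolding power_Suc by (simp only: algebra_simps)
  have ra: "poly r a = of_nat (Suc m) * (a - b') * poly g a"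
    and rb: "poly r b' = of_nat (Suc k) * (b' - a) * poly g b'"
    by (simp_all add: r_def algebra_simps)
  have pos: "0 < poly g a * poly g b'"
    using rcf_no_root_same_sign[of a b' g] b'(1) g_no_root by simp
  have "poly r a * poly r b' = - (of_nat (Suc m) * of_nat (Suc k) * ((b' - a) * (b' - a)) * (poly g a * poly g b'))"
    unfolding ra rb by (simp only: algebra_simps)
  moreover have "0 < of_nat (Suc m) * of_nat (Suc k) * ((b' - a) * (b' - a)) * (poly g a * poly g b')"
  proof (rule mult_pos_pos[OF _ pos])
    show "0 < of_nat (Suc m) * of_nat (Suc k) * ((b' - a) * (b' - a))"
      using b'(1) by (intro mult_pos_pos) (auto simp del: of_nat_Suc)
  qed
  ultimately have "poly r a * poly r b' < 0" by simp
  from rcf_poly_IVT[OF b'(1) this] obtain x where "a < x" "x < b'" "poly r x = 0" by blast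
  with b'(2) p' show ?thesis by (intro exI[of _ x]) auto
qed

text \<open>
  Writing $p = (x - u) g$, Rolle's theorem shows that \<open>g\<close> has no root between \<open>a\<close> and \<open>b\<close>.
\<close>

lemma rcf_simple_root_sign_change:
  fixes p :: "'a::real_closed_field poly"
  assumes "a < u" "u < b" "poly p u = 0" and p': "\<And>x. a < x \<Longrightarrow> x < b \<Longrightarrow> poly (pderiv p) x \<noteq> 0"
  shows "poly p a * poly p b < 0"
proof -
  obtain g where g: "p = [:- u, 1:] * g"
    using assms(3) by (auto simp: poly_eq_0_iff_dvd elim: dvdE)
  have "poly g x \<noteq> 0" if "a \<le> x" "x \<le> b" for x
  proof
    assume "poly g x = 0"
    then have "poly p x = 0" by (simp add: g)
    consider "x = u" | "x < u" | "u < x" by fastforce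
    then show False
    proof cases
      case 1
      have "poly (pderiv p) u = 0"
        using \<open>poly g x = 0\<close> 1 unfolding g pderiv_mult by simp
      with p' assms show False by blast
    next
      case 2
      from rcf_rolle[OF 2 \<open>poly p x = 0\<close> assms(3)] p' that assms show False by force
    next
      case 3
      from rcf_rolle[OF 3 assms(3) \<open>poly p x = 0\<close>] p' that assms show False by force
    qed
  qed
  then have "0 < poly g a * poly g b"
    using assms by (intro rcf_no_root_same_sign) auto
  moreover have "poly p a * poly p b = - ((u - a) * (b - u) * (poly g a * poly g b))"
    by (simp add: g algebra_simps)
  ultimately show ?thesis using assms(1,2) by simp
qed

text \<open>
  The induction on the coefficients needs a positive lower bound in place of mere positivity,
  since the inductive step multiplies by \<open>x\<close> and then adds a constant.
\<close>

lemma poly_sign_at_top: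
  fixes p :: "'a::linordered_field poly"
  assumes "p \<noteq> 0"
  shows "\<exists>M. \<forall>x\<ge>M. 0 < lead_coeff p * poly p x"
proof -
  have "\<exists>M d. 0 < d \<and> (\<forall>x\<ge>M. d \<le> lead_coeff p * poly p x)"
    using assms
  proof (induction p)
    case 0
    then show ?case by simp
  next
    case (pCons a p)
    show ?case
    proof (cases "p = 0")
      case True
      with pCons show ?thesis
        by (intro exI[of _ 0] exI[of _ "a * a"]) (auto simp: zero_less_mult_iff linorder_neq_iff)
    next
      case False
      with pCons obtain M d where M: "0 < d" "\<And>x. x \<ge> M \<Longrightarrow> d \<le> lead_coeff p * poly p x" by blast
      define c where "c = lead_coeff p"
      have "1 \<le> c * (a + x * poly p x)" if x: "x \<ge> max (max M 0) ((1 - c * a) / d)" for x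
      proof -
        have "(1 - c * a) / d \<le> x" using x by simp
        then have "1 - c * a \<le> x * d" using M(1) by (simp add: field_simps)
        also have "\<dots> \<le> x * (c * poly p x)"
          using x M(2)[of x] by (intro mult_left_mono) (auto simp: c_def)
        finally show ?thesis by (simp add: algebra_simps)
      qed
      then show ?thesis using False by (intro exI[of _ "max (max M 0) ((1 - c * a) / d)"] exI[of _ 1]) (simp add: c_def)
    qed
  qed
  then show ?thesis by (meson order_less_le_trans)
qed

section \<open>Sign diagrams of finite sets of polynomials\<close>

text \<open>
  The two numbers may live in different ordered fields, so their signs cannot be compared by an equation.
\<close>

definition same_sign :: "'a::linordered_idom \<Rightarrow> 'b::linordered_idom \<Rightarrow> bool" where
  "same_sign x y \<longleftrightarrow> (0 < x \<longleftrightarrow> 0 < y) \<and> (x < 0 \<longleftrightarrow> y < 0)"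

lemma same_sign_sym: "same_sign x y \<Longrightarrow> same_sign y x"
  by (auto simp: same_sign_def)

lemma same_sign_trans: "same_sign x y \<Longrightarrow> same_sign y z \<Longrightarrow> same_sign x z"
  by (auto simp: same_sign_def)

lemma same_sign_0_iff: "same_sign x y \<Longrightarrow> x = 0 \<longleftrightarrow> y = 0"
  by (auto simp: same_sign_def linorder_neq_iff)

lemma same_sign_mult: "same_sign x y \<Longrightarrow> same_sign x' y' \<Longrightarrow> same_sign (x * x') (y * y')"
  by (auto simp: same_sign_def zero_less_mult_iff mult_less_0_iff)

lemma same_sign_pos_iff: "0 < x * y \<longleftrightarrow> same_sign x y \<and> x \<noteq> 0" for x y :: "'a::linordered_idom"
  by (auto simp: same_sign_def zero_less_mult_iff)

lemma poly_sign_at_ends: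
  fixes p :: "'a::linordered_field poly"
  assumes "p \<noteq> 0"
  shows "\<exists>M>B. (\<forall>x\<ge>M. 0 < lead_coeff p * poly p x) \<and>
     (\<forall>x\<le>-M. 0 < (-1) ^ degree p * lead_coeff p * poly p x)"
proof -
  obtain M1 where M1: "\<And>x. x \<ge> M1 \<Longrightarrow> 0 < lead_coeff p * poly p x"
    using poly_sign_at_top[OF assms] by blast
  let ?q = "pcompose p [:0, -1:]"
  have "?q \<noteq> 0" using assms by (simp add: pcompose_eq_0_iff)
  moreover have "lead_coeff ?q = (-1) ^ degree p * lead_coeff p"
    by (subst lead_coeff_comp) (auto simp: mult.commute)
  ultimately obtain M2 where M2: "\<And>x. x \<ge> M2 \<Longrightarrow> 0 < (-1) ^ degree p * lead_coeff p * poly ?q x"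
    using poly_sign_at_top[of ?q] by metis
  have "0 < (-1) ^ degree p * lead_coeff p * poly p x" if "x \<le> - M2" for x
    using M2[of "- x"] that by (simp add: poly_pcompose minus_le_iff)
  then show ?thesis using M1
    by (intro exI[of _ "max (max M1 M2) (B + 1)"]) (auto simp: less_max_iff_disj)
qed

text \<open>
  The set \<open>R\<close> pairs marked points of one line with marked points of another; \<open>u\<close> and \<open>v\<close> are aligned
  if they have the same position among them, as a marked point or in a gap.
\<close>

definition aligned :: "('a::linorder \<times> 'b::linorder) set \<Rightarrow> 'a \<Rightarrow> 'b \<Rightarrow> bool" where
  "aligned R u v \<longleftrightarrow> (\<forall>(x, y)\<in>R. (u < x \<longleftrightarrow> v < y) \<and> (x < u \<longleftrightarrow> y < v))"

lemma alignedD: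
  "aligned R u v \<Longrightarrow> (x, y) \<in> R \<Longrightarrow> (u < x \<longleftrightarrow> v < y) \<and> (x < u \<longleftrightarrow> y < v)"
  by (auto simp: aligned_def)

lemma aligned_eqD: "aligned R u v \<Longrightarrow> (x, y) \<in> R \<Longrightarrow> u = x \<longleftrightarrow> v = y"
  using linorder_neq_iff[of u x] linorder_neq_iff[of v y] by (auto dest: alignedD)

lemma aligned_converse: "aligned (R\<inverse>) v u \<longleftrightarrow> aligned R u v"
  by (auto simp: aligned_def)

lemma aligned_mono: "aligned R u v \<Longrightarrow> S \<subseteq> R \<Longrightarrow> aligned S u v"
  by (auto simp: aligned_def)

definition matching :: "('a::linorder \<times> 'b::linorder) set \<Rightarrow> bool" where
  "matching R \<longleftrightarrow> finite R \<and> (\<forall>(x, y)\<in>R. aligned R x y)"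

lemma matching_converse: "matching (R\<inverse>) \<longleftrightarrow> matching R"
  by (auto simp: matching_def aligned_converse)

lemma matching_subset: "matching R \<Longrightarrow> S \<subseteq> R \<Longrightarrow> matching S"
  unfolding matching_def by (blast intro: finite_subset aligned_mono)

lemma matchingD: "matching R \<Longrightarrow> (x, y) \<in> R \<Longrightarrow> aligned R x y"
  by (auto simp: matching_def)

text \<open>
  The order of an ordered field is dense and has no endpoints, so every gap between marked points
  is inhabited.
\<close>

lemma matching_aligned_exists:
  fixes R :: "('a::linordered_field \<times> 'b::linordered_field) set"
  assumes "matching R"
  shows "\<exists>v. aligned R u v"
proof (cases "u \<in> fst ` R")
  case True
  then obtain v where "(u, v) \<in> R" by auto
  then show ?thesis using matchingD[OF assms] by blast
next
  case False
  define L U where "L = snd ` {r\<in>R. fst r < u}" and "U = snd ` {r\<in>R. u < fst r}"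
  have fin: "finite L" "finite U"
    using assms by (auto simp: L_def U_def matching_def)
  have LU: "l < r" if "l \<in> L" "r \<in> U" for l r
  proof -
    from that obtain x x' where "(x, l) \<in> R" "x < u" "(x', r) \<in> R" "u < x'"
      by (auto simp: L_def U_def)
    with alignedD[OF matchingD[OF assms, of x l], of x' r] show ?thesis by auto
  qed
  obtain v where v: "\<forall>l\<in>L. l < v" "\<forall>r\<in>U. v < r"
  proof -
    consider "L = {}" "U = {}" | "L \<noteq> {}" "U = {}" | "L = {}" "U \<noteq> {}" | "L \<noteq> {}" "U \<noteq> {}" by blast
    then show thesis
    proof cases
      case 1
      then show thesis using that by auto
    next
      case 2
      obtain v where "Max L < v" using gt_ex by blast
      with 2 that[of v] fin show thesis by (auto simp: Max_less_iff)
    next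
      case 3
      obtain v where "v < Min U" using lt_ex by blast
      with 3 that[of v] fin show thesis by (auto simp: Min_gr_iff)
    next
      case 4
      then have "Max L < Min U" using LU[of "Max L" "Min U"] fin by simp
      from dense[OF this] obtain v where "Max L < v" "v < Min U" by blast
      with 4 that[of v] fin show thesis by (auto simp: Max_less_iff Min_gr_iff)
    qed
  qed
  have "aligned R u v"
    unfolding aligned_def
  proof safe
    fix x y assume xy: "(x, y) \<in> R"
    then have "x \<noteq> u" using False by force
    have "y \<in> L" if "x < u" using that xy by (force simp: L_def)
    moreover have "y \<in> U" if "u < x" using that xy by (force simp: U_def)
    ultimately have *: "x < u \<Longrightarrow> y < v" "u < x \<Longrightarrow> v < y" using v by blast+
    show "u < x \<Longrightarrow> v < y" "x < u \<Longrightarrow> y < v" by (fact *)+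
    show "u < x" if "v < y"
    proof (rule ccontr)
      assume "\<not> u < x"
      with \<open>x \<noteq> u\<close> *(1) that show False by simp
    qed
    show "x < u" if "y < v"
    proof (rule ccontr)
      assume "\<not> x < u"
      with \<open>x \<noteq> u\<close> *(2) that show False by simp
    qed
  qed
  then show ?thesis by blast
qed

lemma finite_neighbours:
  fixes u :: "'a::linorder"
  assumes "finite S" "a \<in> S" "a < u" "b \<in> S" "u < b"
  obtains x x' where "x \<in> S" "x < u" "x' \<in> S" "u < x'" "\<And>z. z \<in> S \<Longrightarrow> z \<noteq> u \<Longrightarrow> z \<le> x \<or> x' \<le> z"
proof -
  let ?L = "{z\<in>S. z < u}" and ?U = "{z\<in>S. u < z}"
  have fin: "finite ?L" "finite ?U" and ne: "?L \<noteq> {}" "?U \<noteq> {}" using assms by auto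
  have "Max ?L \<in> ?L" "Min ?U \<in> ?U" using Max_in[OF fin(1) ne(1)] Min_in[OF fin(2) ne(2)] by auto
  moreover have "z \<le> Max ?L \<or> Min ?U \<le> z" if "z \<in> S" "z \<noteq> u" for z
    using that fin by (cases "z < u") (auto intro!: Max_ge Min_le)
  ultimately show thesis using that[of "Max ?L" "Min ?U"] by auto
qed

lemma matching_neighbours:
  assumes R: "matching R" and uv: "aligned R u v" and u: "u \<notin> fst ` R"
    and ab: "a \<in> fst ` R" "a < u" "b \<in> fst ` R" "u < b"
  obtains x y x' y' where "(x, y) \<in> R" "(x', y') \<in> R" "x < u" "u < x'" "y < v" "v < y'"
    "\<And>w w'. x < w \<Longrightarrow> w < x' \<Longrightarrow> y < w' \<Longrightarrow> w' < y' \<Longrightarrow> aligned R w w'"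
    "\<And>w. x < w \<Longrightarrow> w < x' \<Longrightarrow> w \<notin> fst ` R"
    "\<And>w. y < w \<Longrightarrow> w < y' \<Longrightarrow> w \<notin> snd ` R"
proof -
  have "finite (fst ` R)" using R by (auto simp: matching_def)
  from finite_neighbours[OF this ab] obtain x x' where
    x: "x \<in> fst ` R" "x < u" "x' \<in> fst ` R" "u < x'" and
    gap: "\<And>z. z \<in> fst ` R \<Longrightarrow> z \<noteq> u \<Longrightarrow> z \<le> x \<or> x' \<le> z" by blast
  then obtain y y' where y: "(x, y) \<in> R" "(x', y') \<in> R" by auto
  have gap': "z \<le> x \<and> z' \<le> y \<or> x' \<le> z \<and> y' \<le> z'" if "(z, z') \<in> R" for z z'
  proof -
    have "z \<noteq> u" using that u by force
    moreover have "z \<in> fst ` R" using that by force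
    ultimately consider "z \<le> x" | "x' \<le> z" using gap by blast
    then show ?thesis
    proof cases
      case 1
      then have "z' \<le> y" using alignedD[OF matchingD[OF R that] y(1)] by (meson not_le)
      with 1 show ?thesis by simp
    next
      case 2
      then have "y' \<le> z'" using alignedD[OF matchingD[OF R that] y(2)] by (meson not_le)
      with 2 show ?thesis by simp
    qed
  qed
  show thesis
  proof (rule that[OF y x(2) x(4)])
    show "y < v" "v < y'" using alignedD[OF uv y(1)] alignedD[OF uv y(2)] x by auto
    show "aligned R w w'" if w: "x < w" "w < x'" "y < w'" "w' < y'" for w w'
      unfolding aligned_def
    proof clarify
      fix z z' assume "(z, z') \<in> R"
      from gap'[OF this] show "(w < z \<longleftrightarrow> w' < z') \<and> (z < w \<longleftrightarrow> z' < w')"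
        using w by (auto dest: order_le_less_trans order_less_le_trans order_less_asym)
    qed
    show "w \<notin> fst ` R" if "x < w" "w < x'" for w
      using gap' that by (metis imageE prod.collapse not_le)
    show "w \<notin> snd ` R" if "y < w" "w < y'" for w
      using gap' that by (metis imageE prod.collapse not_le)
  qed
qed

text \<open>
  The pairs in \<open>G\<close> have the same sign diagram over the two fields, with all roots marked.  The root conditions
  exclude the zero polynomial; they make the diagram symmetric in the two fields and allow marked
  points that are not roots to be removed.
\<close>

definition same_diagram ::
    "('a::linordered_field \<times> 'b::linordered_field) set \<Rightarrow> ('a poly \<times> 'b poly) set \<Rightarrow> bool" where
  "same_diagram R G \<longleftrightarrow> matching R \<and>
     (\<forall>(g, h)\<in>G. (\<forall>u v. aligned R u v \<longrightarrow> same_sign (poly g u) (poly h v)) \<and>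
        (\<forall>u. poly g u = 0 \<longrightarrow> u \<in> fst ` R) \<and> (\<forall>v. poly h v = 0 \<longrightarrow> v \<in> snd ` R))"

lemma same_diagramD:
  assumes "same_diagram R G" "(g, h) \<in> G"
  shows "aligned R u v \<Longrightarrow> same_sign (poly g u) (poly h v)"
    and "poly g u = 0 \<Longrightarrow> u \<in> fst ` R" and "poly h v = 0 \<Longrightarrow> v \<in> snd ` R"
  using assms by (auto simp: same_diagram_def)

lemma same_diagram_subset: "same_diagram R G \<Longrightarrow> H \<subseteq> G \<Longrightarrow> same_diagram R H"
  unfolding same_diagram_def by blast

lemma aligned_no_root_same_sign:
  fixes h :: "'b::real_closed_field poly"
  assumes "aligned R u v" "aligned R u v'" "u \<notin> fst ` R" and roots: "\<And>y. poly h y = 0 \<Longrightarrow> y \<in> snd ` R"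
  shows "same_sign (poly h v) (poly h v')"
proof -
  have between: False if "a \<le> y" "y \<le> b" "(x, y) \<in> R" "aligned R u a" "aligned R u b" for a b x y
  proof -
    have "x \<noteq> u" using assms(3) that by force
    then consider "x < u" | "u < x" by fastforce
    then show False
      using alignedD[OF that(4,3)] alignedD[OF that(5,3)] that(1,2) by cases auto
  qed
  have *: "0 < poly h a * poly h b" if "a \<le> b" "aligned R u a" "aligned R u b" for a b
  proof (rule rcf_no_root_same_sign[OF that(1)])
    fix y assume y: "a \<le> y" "y \<le> b"
    show "poly h y \<noteq> 0"
    proof
      assume "poly h y = 0"
      then obtain x where "(x, y) \<in> R" using roots by force
      with between y that show False by blast
    qed
  qed
  show ?thesis
    using *[of v v'] *[of v' v] assms(1,2) by (cases "v \<le> v'") (auto simp: same_sign_pos_iff intro: same_sign_sym)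
qed

text \<open>
  Before a polynomial is added, all marked points that are not roots have to go, because its sign is
  controlled only at the roots of the others.  Removing a marked point merges two gaps, and on
  the merged gap the signs still agree because no polynomial in \<open>G\<close> has a root there.
\<close>

lemma same_diagram_restrict:
  fixes G :: "('a::real_closed_field poly \<times> 'b::real_closed_field poly) set"
  assumes R: "same_diagram R G"
  shows "same_diagram {(x, y)\<in>R. \<exists>(g, h)\<in>G. poly g x = 0} G" (is "same_diagram ?S G")
proof -
  have M: "matching R" using R by (simp add: same_diagram_def)
  have S: "matching ?S" by (rule matching_subset[OF M]) auto
  have roots: "u \<in> fst ` ?S" if gh: "(g, h) \<in> G" and "poly g u = 0" for g h u
    using same_diagramD(2)[OF R that] that by force
  have roots': "v \<in> snd ` ?S" if gh: "(g, h) \<in> G" and "poly h v = 0" for g h v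
  proof -
    have "v \<in> snd ` R" using same_diagramD(3)[OF R gh] that by blast
    then obtain u where uv: "(u, v) \<in> R" by force
    from same_diagramD(1)[OF R gh matchingD[OF M uv]] have "poly g u = 0"
      using that by (simp add: same_sign_0_iff)
    then show ?thesis using uv gh by force
  qed
  have sign: "same_sign (poly g u) (poly h v)" if gh: "(g, h) \<in> G" and uv: "aligned ?S u v" for g h u v
  proof (cases "u \<in> fst ` ?S")
    case True
    then obtain y where y: "(u, y) \<in> ?S" by force
    then have "y = v" using aligned_eqD[OF uv y] by simp
    with y show ?thesis using same_diagramD(1)[OF R gh matchingD[OF M]] by auto
  next
    case False
    obtain v' where v': "aligned R u v'" using matching_aligned_exists[OF M] by blast
    then have "aligned ?S u v'" by (rule aligned_mono) auto
    from aligned_no_root_same_sign[OF this uv False] roots'[OF gh]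
    have "same_sign (poly h v') (poly h v)" by blast
    then show ?thesis using same_diagramD(1)[OF R gh v'] by (rule same_sign_trans[rotated])
  qed
  show ?thesis
    unfolding same_diagram_def using S roots roots' sign by blast
qed

text \<open>
  If \<open>u\<close> is not marked, the derivative of \<open>p\<close> has no root in the gap around \<open>u\<close>.  Hence \<open>p\<close>
  changes sign between the ends of the gap, and so does \<open>q\<close>.
\<close>

lemma matching_root_exists:
  fixes p :: "'a::real_closed_field poly" and q :: "'b::real_closed_field poly"
  assumes R: "matching R" and sign: "\<And>x y. (x, y) \<in> R \<Longrightarrow> same_sign (poly p x) (poly q y)"
    and p': "\<And>u. poly (pderiv p) u = 0 \<Longrightarrow> u \<in> fst ` R"
    and u: "poly p u = 0" and ab: "a \<in> fst ` R" "a \<le> u" "b \<in> fst ` R" "u \<le> b"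
  shows "\<exists>v. aligned R u v \<and> poly q v = 0"
proof (cases "u \<in> fst ` R")
  case True
  then obtain v where uv: "(u, v) \<in> R" by auto
  then have "poly q v = 0" using same_sign_0_iff[OF sign[OF uv]] u by simp
  with matchingD[OF R uv] show ?thesis by blast
next
  case False
  with ab have ab': "a < u" "u < b" by (auto simp: order_le_less)
  obtain v0 where v0: "aligned R u v0" using matching_aligned_exists[OF R] by blast
  from matching_neighbours[OF R v0 False ab(1) ab'(1) ab(3) ab'(2)]
  obtain x y x' y' where n: "(x, y) \<in> R" "(x', y') \<in> R" "x < u" "u < x'" "y < v0" "v0 < y'"
    and al: "\<And>w w'. x < w \<Longrightarrow> w < x' \<Longrightarrow> y < w' \<Longrightarrow> w' < y' \<Longrightarrow> aligned R w w'"
    and gap: "\<And>w. x < w \<Longrightarrow> w < x' \<Longrightarrow> w \<notin> fst ` R" by metis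
  have "poly p x * poly p x' < 0"
    using p' gap by (intro rcf_simple_root_sign_change[OF n(3,4) u]) blast
  then have "poly q y * poly q y' < 0"
    using same_sign_mult[OF sign[OF n(1)] sign[OF n(2)]] by (simp add: same_sign_def)
  from rcf_poly_IVT[OF _ this] n obtain v where "y < v" "v < y'" "poly q v = 0" by force
  then show ?thesis using al n by blast
qed

text \<open>
  The inductive step of the comparison of diagrams.  Mark one further point on either side beyond all
  roots, where the sign is that of the leading term.  In each gap, which contains no root of the derivative, \<open>p\<close> has at most one
  root, and whether it has one is read off from the signs at the ends of the gap; so the roots of \<open>p\<close> and of \<open>q\<close>
  correspond.  Once they are marked too, the sign in a gap is the sign at one of its ends:
  by Rolle's theorem \<open>p\<close> does not vanish at both.
\<close>

lemma same_diagram_insert: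
  fixes p :: "'a::real_closed_field poly" and q :: "'b::real_closed_field poly"
  assumes R: "same_diagram R G" and p'q': "(pderiv p, pderiv q) \<in> G"
    and deg: "degree p = degree q" "p \<noteq> 0" "q \<noteq> 0" and lc: "same_sign (lead_coeff p) (lead_coeff q)"
    and at_roots: "\<And>g h u v. (g, h) \<in> G \<Longrightarrow> poly g u = 0 \<Longrightarrow> poly h v = 0 \<Longrightarrow> aligned R u v
       \<Longrightarrow> same_sign (poly p u) (poly q v)"
  shows "\<exists>S. same_diagram S (insert (p, q) G)"
proof -
  define R0 where "R0 = {(x, y)\<in>R. \<exists>(g, h)\<in>G. poly g x = 0}"
  have R0: "same_diagram R0 G" unfolding R0_def by (rule same_diagram_restrict[OF R])
  have M0: "matching R0" using R0 by (simp add: same_diagram_def)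
  have MR: "matching R" using R by (simp add: same_diagram_def)
  have sign0: "same_sign (poly p x) (poly q y)" if "(x, y) \<in> R0" for x y
  proof -
    from that obtain g h where gh: "(g, h) \<in> G" "poly g x = 0" and xy: "(x, y) \<in> R"
      by (auto simp: R0_def)
    have al: "aligned R x y" using matchingD[OF MR xy] .
    with same_diagramD(1)[OF R gh(1)] gh(2) have "poly h y = 0" by (auto dest: same_sign_0_iff)
    with at_roots gh al show ?thesis by blast
  qed
  have fin: "finite R0" using M0 by (simp add: matching_def)
  define B where "B = Max (insert 0 ((\<lambda>(x, y). \<bar>x\<bar>) ` R0))"
  define B' where "B' = Max (insert 0 ((\<lambda>(x, y). \<bar>y\<bar>) ` R0))"
  have B: "\<bar>x\<bar> \<le> B" "\<bar>y\<bar> \<le> B'" if "(x, y) \<in> R0" for x y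
    unfolding B_def B'_def using fin that by (force intro!: Max_ge)+
  have B0: "0 \<le> B" "0 \<le> B'" using fin by (auto simp: B_def B'_def)
  obtain b where b: "B < b" "\<And>x. b \<le> x \<Longrightarrow> 0 < lead_coeff p * poly p x"
      "\<And>x. x \<le> - b \<Longrightarrow> 0 < (-1) ^ degree p * lead_coeff p * poly p x"
    using poly_sign_at_ends[OF deg(2), of B] by blast
  obtain b' where b': "B' < b'" "\<And>x. b' \<le> x \<Longrightarrow> 0 < lead_coeff q * poly q x"
      "\<And>x. x \<le> - b' \<Longrightarrow> 0 < (-1) ^ degree q * lead_coeff q * poly q x"
    using poly_sign_at_ends[OF deg(3), of B'] by blast
  have right: "same_sign (poly p x) (poly q y)" if "b \<le> x" "b' \<le> y" for x y
    using b(2)[OF that(1)] b'(2)[OF that(2)] lc by (auto simp: same_sign_def zero_less_mult_iff)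
  have left: "same_sign (poly p x) (poly q y)" if "x \<le> - b" "y \<le> - b'" for x y
    using b(3)[OF that(1)] b'(3)[OF that(2)] lc deg(1)
    by (cases "even (degree p)") (auto simp: same_sign_def zero_less_mult_iff mult_less_0_iff)
  \<comment> \<open>The extra points bound every gap that can contain a root.\<close>
  define R1 where "R1 = {(- b, - b'), (b, b')} \<union> R0"
  have in0: "- b < x \<and> x < b \<and> - b' < y \<and> y < b'" if "(x, y) \<in> R0" for x y
    using B[OF that] b(1) b'(1) by (auto simp: abs_le_iff)
  have M1: "matching R1"
    unfolding matching_def
  proof (intro conjI ballI)
    show "finite R1" using fin by (simp add: R1_def)
    fix r assume "r \<in> R1"
    then show "case r of (x, y) \<Rightarrow> aligned R1 x y"
      using b(1) b'(1) B0 alignedD[OF matchingD[OF M0]]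
      by (auto simp: R1_def aligned_def dest: in0)
  qed
  have R1R0: "aligned R0 u v" if "aligned R1 u v" for u v
    using that by (rule aligned_mono) (auto simp: R1_def)
  have sign1: "same_sign (poly p x) (poly q y)" if "(x, y) \<in> R1" for x y
    using that sign0 right[of b b'] left[of "- b" "- b'"] by (auto simp: R1_def)
  have p'_roots: "u \<in> fst ` R1" if "poly (pderiv p) u = 0" for u
    using same_diagramD(2)[OF R0 p'q' that] by (auto simp: R1_def)
  have q'_roots: "v \<in> snd ` R1" if "poly (pderiv q) v = 0" for v
    using same_diagramD(3)[OF R0 p'q' that] by (auto simp: R1_def)
  have p_bound: "- b \<le> u \<and> u \<le> b" if "poly p u = 0" for u
    using b(2)[of u] b(3)[of u] that by (cases "b \<le> u"; cases "u \<le> - b") auto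
  have q_bound: "- b' \<le> v \<and> v \<le> b'" if "poly q v = 0" for v
    using b'(2)[of v] b'(3)[of v] that by (cases "b' \<le> v"; cases "v \<le> - b'") auto
  have ends: "- b \<in> fst ` R1" "b \<in> fst ` R1" "- b' \<in> snd ` R1" "b' \<in> snd ` R1"
    by (auto simp: R1_def)
  have root_right: "\<exists>v. aligned R1 u v \<and> poly q v = 0" if "poly p u = 0" for u
    using matching_root_exists[OF M1 sign1 p'_roots that, of "- b" b] p_bound[OF that] ends by blast
  have root_left: "\<exists>u. aligned R1 u v \<and> poly p u = 0" if "poly q v = 0" for v
  proof -
    have "\<exists>u. aligned (R1\<inverse>) v u \<and> poly p u = 0"
    proof (rule matching_root_exists[of "R1\<inverse>" q p v "- b'" b'])
      have fst: "fst ` (R1\<inverse>) = snd ` R1" by force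
      show "matching (R1\<inverse>)" using M1 by (simp add: matching_converse)
      show "same_sign (poly q x) (poly p y)" if "(x, y) \<in> R1\<inverse>" for x y
        using that sign1 by (auto intro: same_sign_sym)
      show "u \<in> fst ` (R1\<inverse>)" if "poly (pderiv q) u = 0" for u
        using q'_roots[OF that] unfolding fst .
      show "- b' \<in> fst ` (R1\<inverse>)" "b' \<in> fst ` (R1\<inverse>)" using ends unfolding fst by auto
    qed (use that q_bound[OF that] in auto)
    then show ?thesis by (simp add: aligned_converse)
  qed
  \<comment> \<open>The new marked points: aligned pairs of roots.\<close>
  define N where "N = {(u, v). aligned R1 u v \<and> poly p u = 0 \<and> poly q v = 0}"
  have finN: "finite N"
  proof (rule finite_subset)
    show "N \<subseteq> {u. poly p u = 0} \<times> {v. poly q v = 0}" by (auto simp: N_def)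
    show "finite ({u. poly p u = 0} \<times> {v. poly q v = 0})"
      using poly_roots_finite[OF deg(2)] poly_roots_finite[OF deg(3)] by simp
  qed
  have sepN: "v < v2" if uv: "(u, v) \<in> N" "(u2, v2) \<in> N" "u < u2" for u v u2 v2
  proof -
    obtain x where x: "u < x" "x < u2" "poly (pderiv p) x = 0"
      using rcf_rolle[OF uv(3)] uv by (auto simp: N_def)
    then obtain y where "(x, y) \<in> R1" using p'_roots by force
    then have "v < y" "y < v2" using x uv alignedD[of R1] by (auto simp: N_def)
    then show ?thesis by simp
  qed
  have sepN': "u < u2" if uv: "(u, v) \<in> N" "(u2, v2) \<in> N" "v < v2" for u v u2 v2
  proof -
    obtain y where y: "v < y" "y < v2" "poly (pderiv q) y = 0"
      using rcf_rolle[OF uv(3)] uv by (auto simp: N_def)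
    then obtain x where "(x, y) \<in> R1" using q'_roots by force
    then have "u < x" "x < u2" using y uv alignedD[of R1] by (auto simp: N_def)
    then show ?thesis by simp
  qed
  define R2 where "R2 = R1 \<union> N"
  have R2R1: "aligned R1 u v" if "aligned R2 u v" for u v
    using that by (rule aligned_mono) (auto simp: R2_def)
  have M2: "matching R2"
    unfolding matching_def
  proof (intro conjI ballI)
    show "finite R2" using M1 finN by (simp add: R2_def matching_def)
    fix r assume r: "r \<in> R2"
    obtain u v where uv: "r = (u, v)" by force
    have al: "aligned R1 u v"
      using r uv matchingD[OF M1] by (auto simp: R2_def N_def)
    have "aligned N u v"
      unfolding aligned_def
    proof clarify
      fix u2 v2 assume N2: "(u2, v2) \<in> N"
      show "(u < u2 \<longleftrightarrow> v < v2) \<and> (u2 < u \<longleftrightarrow> v2 < v)"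
      proof (cases "(u, v) \<in> N")
        case True
        then show ?thesis using sepN[OF True N2] sepN'[OF True N2] sepN[OF N2 True] sepN'[OF N2 True] by blast
      next
        case False
        then have "(u, v) \<in> R1" using r uv by (auto simp: R2_def)
        from alignedD[OF _ this, of u2 v2] N2 show ?thesis by (auto simp: N_def)
      qed
    qed
    with al show "case r of (x, y) \<Rightarrow> aligned R2 x y"
      by (auto simp: uv R2_def aligned_def)
  qed
  have p_roots: "u \<in> fst ` R2" if "poly p u = 0" for u
    using root_right[OF that] that by (force simp: R2_def N_def)
  have q_roots: "v \<in> snd ` R2" if "poly q v = 0" for v
    using root_left[OF that] that by (force simp: R2_def N_def)
  have sign2: "same_sign (poly p x) (poly q y)" if "(x, y) \<in> R2" for x y
    using that sign1 by (auto simp: R2_def N_def same_sign_def)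
  have sign: "same_sign (poly p u) (poly q v)" if uv: "aligned R2 u v" for u v
  proof (cases "u \<in> fst ` R2")
    case True
    then obtain y where y: "(u, y) \<in> R2" by force
    with aligned_eqD[OF uv y] sign2 show ?thesis by auto
  next
    case False
    have bb: "(- b, - b') \<in> R2" "(b, b') \<in> R2" by (auto simp: R2_def R1_def)
    then have "u \<noteq> b" "u \<noteq> - b" using False by force+
    then consider "u < - b" | "b < u" | "- b < u" "u < b" by fastforce
    then show ?thesis
    proof cases
      case 1
      then show ?thesis using alignedD[OF uv bb(1)] by (intro left) auto
    next
      case 2
      then show ?thesis using alignedD[OF uv bb(2)] by (intro right) auto
    next
      case 3
      have "- b \<in> fst ` R2" "b \<in> fst ` R2" using bb by force+
      from matching_neighbours[OF M2 uv False this(1) 3(1) this(2) 3(2)]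
      obtain x y x' y' where n: "(x, y) \<in> R2" "(x', y') \<in> R2" "x < u" "u < x'" "y < v" "v < y'"
        and gap: "\<And>w. x < w \<Longrightarrow> w < x' \<Longrightarrow> w \<notin> fst ` R2" "\<And>w. y < w \<Longrightarrow> w < y' \<Longrightarrow> w \<notin> snd ` R2" by metis
      have nz: "poly p w \<noteq> 0" if "x < w" "w < x'" for w using gap(1)[OF that] p_roots by blast
      have nz': "poly q w \<noteq> 0" if "y < w" "w < y'" for w using gap(2)[OF that] q_roots by blast
      have "poly p x \<noteq> 0 \<or> poly p x' \<noteq> 0"
      proof (rule ccontr)
        assume "\<not> ?thesis"
        with rcf_rolle[of x x' p] n obtain w where "x < w" "w < x'" "poly (pderiv p) w = 0" by auto
        with gap(1) p'_roots show False by (force simp: R2_def)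
      qed
      then show ?thesis
      proof
        assume x: "poly p x \<noteq> 0"
        then have y: "poly q y \<noteq> 0" using same_sign_0_iff[OF sign2[OF n(1)]] by simp
        have "0 < poly p x * poly p u"
          using x nz n by (intro rcf_no_root_same_sign) (auto simp: order_le_less)
        moreover have "0 < poly q y * poly q v"
          using y nz' n by (intro rcf_no_root_same_sign) (auto simp: order_le_less)
        ultimately show ?thesis using sign2[OF n(1)] by (auto simp: same_sign_def zero_less_mult_iff)
      next
        assume x: "poly p x' \<noteq> 0"
        then have y: "poly q y' \<noteq> 0" using same_sign_0_iff[OF sign2[OF n(2)]] by simp
        have "0 < poly p u * poly p x'"
          using x nz n by (intro rcf_no_root_same_sign) (auto simp: order_le_less)
        moreover have "0 < poly q v * poly q y'"
          using y nz' n by (intro rcf_no_root_same_sign) (auto simp: order_le_less)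
        ultimately show ?thesis using sign2[OF n(2)] by (auto simp: same_sign_def zero_less_mult_iff)
      qed
    qed
  qed
  have "same_diagram R2 (insert (p, q) G)"
    unfolding same_diagram_def
  proof (intro conjI ballI)
    show "matching R2" by (fact M2)
    fix r assume r: "r \<in> insert (p, q) G"
    obtain g h where gh: "r = (g, h)" by force
    have "(\<forall>u v. aligned R2 u v \<longrightarrow> same_sign (poly g u) (poly h v)) \<and>
        (\<forall>u. poly g u = 0 \<longrightarrow> u \<in> fst ` R2) \<and> (\<forall>v. poly h v = 0 \<longrightarrow> v \<in> snd ` R2)"
    proof (cases "(g, h) \<in> G")
      case True
      then show ?thesis
        using same_diagramD[OF R0 True] R1R0[OF R2R1] unfolding R2_def R1_def image_Un by blast
    next
      case False
      with r gh sign p_roots q_roots show ?thesis by auto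
    qed
    then show "case r of (g, h) \<Rightarrow> (\<forall>u v. aligned R2 u v \<longrightarrow> same_sign (poly g u) (poly h v)) \<and>
        (\<forall>u. poly g u = 0 \<longrightarrow> u \<in> fst ` R2) \<and> (\<forall>v. poly h v = 0 \<longrightarrow> v \<in> snd ` R2)"
      by (simp add: gh)
  qed
  then show ?thesis by blast
qed

section \<open>Ring morphisms and specialization of sign diagrams\<close>

definition ring_morphism :: "('a::comm_ring_1 \<Rightarrow> 'b::comm_ring_1) \<Rightarrow> bool" where
  "ring_morphism h \<longleftrightarrow> h 1 = 1 \<and> (\<forall>x y. h (x + y) = h x + h y) \<and> (\<forall>x y. h (x * y) = h x * h y)"

lemma ring_morphism_1: "ring_morphism h \<Longrightarrow> h 1 = 1"
  and ring_morphism_add: "ring_morphism h \<Longrightarrow> h (x + y) = h x + h y"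
  and ring_morphism_mult: "ring_morphism h \<Longrightarrow> h (x * y) = h x * h y"
  by (auto simp: ring_morphism_def)

lemma ring_morphism_0: "ring_morphism h \<Longrightarrow> h 0 = 0"
  using ring_morphism_add[of h 0 0] by simp

lemma ring_morphism_of_nat: "ring_morphism h \<Longrightarrow> h (of_nat n) = of_nat n"
  by (induction n) (simp_all add: ring_morphism_0 ring_morphism_1 ring_morphism_add)

lemma ring_morphism_sum: "ring_morphism h \<Longrightarrow> h (\<Sum>i\<in>A. f i) = (\<Sum>i\<in>A. h (f i))"
  by (induction A rule: infinite_finite_induct) (simp_all add: ring_morphism_0 ring_morphism_add)

lemma ring_morphism_prod: "ring_morphism h \<Longrightarrow> h (\<Prod>i\<in>A. f i) = (\<Prod>i\<in>A. h (f i))"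
  by (induction A rule: infinite_finite_induct) (simp_all add: ring_morphism_1 ring_morphism_mult)

lemma ring_morphism_power: "ring_morphism h \<Longrightarrow> h (x ^ n) = h x ^ n"
  by (induction n) (simp_all add: ring_morphism_1 ring_morphism_mult)

lemma ring_morphism_uminus: "ring_morphism h \<Longrightarrow> h (- x) = - h x"
  using ring_morphism_add[of h x "- x"] by (simp add: ring_morphism_0 eq_neg_iff_add_eq_0 add.commute)

lemma map_poly_ring_morphism: "ring_morphism h \<Longrightarrow> ring_morphism (map_poly h)"
  unfolding ring_morphism_def[of "map_poly h"]
  by (auto intro!: poly_eqI simp: coeff_map_poly coeff_mult ring_morphism_0 ring_morphism_1
      ring_morphism_add ring_morphism_mult ring_morphism_sum)

text \<open>
  The derivative over an arbitrary commutative ring, where \<open>pderiv\<close> would ask for coefficients without zero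
  divisors.
\<close>

definition formal_pderiv :: "'a::comm_ring_1 poly \<Rightarrow> 'a poly" where
  "formal_pderiv f = (\<Sum>i\<le>degree f. monom (of_nat (Suc i) * coeff f (Suc i)) i)"

lemma coeff_formal_pderiv: "coeff (formal_pderiv f) n = of_nat (Suc n) * coeff f (Suc n)"
  by (auto simp: formal_pderiv_def coeff_sum coeff_eq_0)

lemma map_poly_formal_pderiv:
  fixes h :: "'a::comm_ring_1 \<Rightarrow> 'b::idom"
  assumes "ring_morphism h"
  shows "map_poly h (formal_pderiv f) = pderiv (map_poly h f)"
  by (rule poly_eqI) (simp add: coeff_map_poly ring_morphism_0[OF assms] coeff_formal_pderiv
      coeff_pderiv ring_morphism_mult[OF assms] ring_morphism_of_nat[OF assms] del: of_nat_Suc)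

text \<open>
  Multiplying by a square, instead of an arbitrary power of the leading coefficient, keeps the sign
  of the remainder at the roots of \<open>g\<close> equal to the sign of \<open>f\<close>.
\<close>

lemma even_pseudo_remainder:
  fixes f g :: "'a::comm_ring_1 poly"
  assumes "g \<noteq> 0"
  shows "\<exists>c q r. smult (c * c) f = g * q + r \<and> (r = 0 \<or> degree r < degree g) \<and> (\<exists>k. c = lead_coeff g ^ k)"
proof -
  obtain q r where qr: "pseudo_divmod f g = (q, r)" by force
  define c where "c = lead_coeff g ^ (Suc (degree f) - degree g)"
  have *: "smult c f = g * q + r" "r = 0 \<or> degree r < degree g"
    using pseudo_divmod[OF assms qr] by (auto simp: c_def)
  have "smult (c * c) f = smult c (g * q + r)"
    unfolding *(1)[symmetric] by simp
  then have "smult (c * c) f = g * smult c q + smult c r"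
    by (simp add: smult_add_right)
  moreover have "smult c r = 0 \<or> degree (smult c r) < degree g"
    using *(2) degree_smult_le[of c r] by auto
  ultimately show ?thesis unfolding c_def by blast
qed

text \<open>
  A ring of coefficients is evaluated in one real closed field by \<open>e0\<close> and, at points \<open>a\<close> near the filter \<open>F\<close>,
  in another one by \<open>e a\<close>, such that eventually every coefficient has the right sign.  The filter hides which
  finitely many coefficients a given argument depends on.
\<close>

locale sign_specialization =
  fixes e0 :: "'r::comm_ring_1 \<Rightarrow> 'k::real_closed_field"
    and e :: "'p \<Rightarrow> 'r \<Rightarrow> 'l::real_closed_field"
    and F :: "'p filter"
  assumes e0: "ring_morphism e0" and e: "\<And>a. ring_morphism (e a)"
    and sign: "\<And>c. eventually (\<lambda>a. same_sign (e0 c) (e a c)) F"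
begin

abbreviation "ev0 \<equiv> map_poly e0"
abbreviation "ev a \<equiv> map_poly (e a)"

lemmas coeff_ev0 = coeff_map_poly[of e0, OF ring_morphism_0[OF e0]]
lemmas coeff_ev = coeff_map_poly[of "e a" for a, OF ring_morphism_0[OF e]]

text \<open>
  For these polynomials degrees are preserved by both evaluations, by \<open>ev a\<close> eventually.
\<close>

definition surviving :: "'r poly \<Rightarrow> bool" where
  "surviving f \<longleftrightarrow> e0 (lead_coeff f) \<noteq> 0"

text \<open>
  Removes the leading coefficients that vanish under \<open>e0\<close>; eventually this changes neither evaluation.
\<close>

definition trunc :: "'r poly \<Rightarrow> 'r poly" where
  "trunc f = poly_cutoff (if ev0 f = 0 then 0 else Suc (degree (ev0 f))) f"

lemma coeff_trunc: "coeff (trunc f) i = (if coeff (ev0 f) i = 0 \<and> (ev0 f = 0 \<or> degree (ev0 f) < i) then 0 else coeff f i)"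
  by (auto simp: trunc_def coeff_poly_cutoff coeff_eq_0)

lemma ev0_trunc: "ev0 (trunc f) = ev0 f"
proof (rule poly_eqI)
  fix i
  have "coeff (ev0 (trunc f)) i = e0 (coeff (trunc f) i)" by (rule coeff_ev0)
  also have "\<dots> = coeff (ev0 f) i"
    by (simp add: coeff_trunc ring_morphism_0[OF e0] coeff_ev0[of f])
  finally show "coeff (ev0 (trunc f)) i = coeff (ev0 f) i" .
qed

lemma eventually_ev_trunc: "eventually (\<lambda>a. ev a (trunc f) = ev a f) F"
proof -
  have "eventually (\<lambda>a. \<forall>i\<in>{..degree f}. same_sign (e0 (coeff f i)) (e a (coeff f i))) F"
    by (intro eventually_ball_finite) (auto intro: sign)
  then show ?thesis
  proof eventually_elim
    case (elim a)
    show ?case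
    proof (rule poly_eqI)
      fix i
      show "coeff (ev a (trunc f)) i = coeff (ev a f) i"
      proof (cases "coeff (ev0 f) i = 0")
        case True
        then have "e a (coeff f i) = 0"
          using elim same_sign_0_iff by (cases "i \<le> degree f") (auto simp: coeff_ev0 coeff_eq_0 ring_morphism_0[OF e])
        then show ?thesis by (simp add: coeff_ev coeff_trunc ring_morphism_0[OF e])
      next
        case False
        then show ?thesis by (simp add: coeff_ev coeff_trunc)
      qed
    qed
  qed
qed

lemma surviving_degree:
  assumes "surviving f"
  shows "degree (ev0 f) = degree f" "lead_coeff (ev0 f) = e0 (lead_coeff f)" "ev0 f \<noteq> 0" "f \<noteq> 0"
proof -
  show "lead_coeff (ev0 f) = e0 (lead_coeff f)"
    using assms by (intro lead_coeff_map_poly_nz) (auto simp: surviving_def ring_morphism_0[OF e0])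
  with assms show "ev0 f \<noteq> 0" by (auto simp: surviving_def)
  then show "f \<noteq> 0" by auto
  show "degree (ev0 f) = degree f"
    using assms by (intro antisym[OF map_poly_degree_leq] le_degree) (simp add: coeff_ev0 surviving_def)
qed

lemma surviving_eventually:
  assumes "surviving f"
  shows "eventually (\<lambda>a. degree (ev a f) = degree f \<and> ev a f \<noteq> 0 \<and>
     same_sign (lead_coeff (ev0 f)) (lead_coeff (ev a f))) F"
  using sign[of "lead_coeff f"]
proof eventually_elim
  case (elim a)
  then have nz: "e a (lead_coeff f) \<noteq> 0" using assms by (auto simp: surviving_def dest: same_sign_0_iff)
  then have lc: "lead_coeff (ev a f) = e a (lead_coeff f)"
    by (intro lead_coeff_map_poly_nz) (auto simp: ring_morphism_0[OF e])
  have "degree (ev a f) = degree f"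
    using nz by (intro antisym[OF map_poly_degree_leq] le_degree) (simp add: coeff_ev)
  then show ?case using nz lc elim surviving_degree(2)[OF assms] by auto
qed

lemma surviving_trunc: "ev0 f \<noteq> 0 \<Longrightarrow> surviving (trunc f)"
proof -
  assume nz: "ev0 f \<noteq> 0"
  let ?n = "degree (ev0 f)"
  have "coeff (trunc f) i = 0" if "?n < i" for i
    using that by (simp add: trunc_def coeff_poly_cutoff)
  then have "degree (trunc f) \<le> ?n" by (intro degree_le) auto
  moreover have c: "e0 (coeff (trunc f) ?n) \<noteq> 0"
    using nz by (simp add: trunc_def coeff_poly_cutoff flip: coeff_ev0)
  then have "?n \<le> degree (trunc f)" by (intro le_degree) (auto simp: ring_morphism_0[OF e0])
  ultimately show "surviving (trunc f)" using c by (simp add: surviving_def)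
qed

lemma degree_trunc: "ev0 f \<noteq> 0 \<Longrightarrow> degree (trunc f) = degree (ev0 f)"
  using surviving_degree(1)[OF surviving_trunc] by (simp add: ev0_trunc)

definition specializes :: "'r poly set \<Rightarrow> bool" where
  "specializes G \<longleftrightarrow> eventually (\<lambda>a. \<exists>R. same_diagram R ((\<lambda>f. (ev0 f, ev a f)) ` G)) F"

text \<open>
  The diagram of \<open>G\<close>, of the derivative of \<open>p\<close> and of the remainders of \<open>p\<close> modulo these polynomials is
  available by \<open>IH\<close>.  At a root of a divisor the sign of \<open>p\<close> is that of the remainder, which is what
  \<open>same_diagram_insert\<close> requires.
\<close>

lemma specializes_insert:
  assumes fin: "finite G" and surviving: "\<And>g. g \<in> G \<Longrightarrow> surviving g" and p: "surviving p" "0 < degree p"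
    and deg: "\<And>g. g \<in> G \<Longrightarrow> degree g \<le> degree p"
    and IH: "\<And>E. finite E \<Longrightarrow> (\<And>f. f \<in> E \<Longrightarrow> surviving f \<and> degree f < degree p) \<Longrightarrow> specializes (G \<union> E)"
  shows "specializes (insert p G)"
proof -
  have nz': "pderiv (ev0 p) \<noteq> 0"
    using surviving_degree(1)[OF p(1)] p(2) by (simp add: pderiv_eq_0_iff)
  define p' where "p' = trunc (formal_pderiv p)"
  have ev0_p': "ev0 p' = pderiv (ev0 p)"
    by (simp add: p'_def ev0_trunc map_poly_formal_pderiv[OF e0])
  have p': "surviving p'" "degree p' < degree p"
    using surviving_trunc[of "formal_pderiv p"] degree_trunc[of "formal_pderiv p"] nz' p(2) surviving_degree(1)[OF p(1)]
    by (auto simp: p'_def map_poly_formal_pderiv[OF e0] degree_pderiv)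
  have ev_p': "eventually (\<lambda>a. ev a p' = pderiv (ev a p)) F"
    using eventually_ev_trunc[of "formal_pderiv p"] by (simp add: p'_def map_poly_formal_pderiv[OF e])
  define Z where "Z = insert p' G"
  have Z: "finite Z" "\<And>g. g \<in> Z \<Longrightarrow> surviving g" using fin surviving p' by (auto simp: Z_def)
  have "\<forall>g\<in>Z. \<exists>c q r. smult (c * c) p = g * q + r \<and> (r = 0 \<or> degree r < degree g) \<and> (\<exists>k. c = lead_coeff g ^ k)"
    using even_pseudo_remainder surviving_degree(4) Z(2) by blast
  then obtain c q r where cqr: "\<And>g. g \<in> Z \<Longrightarrow> smult (c g * c g) p = g * q g + r g"
    and deg_r: "\<And>g. g \<in> Z \<Longrightarrow> r g = 0 \<or> degree (r g) < degree g"
    and c: "\<And>g. g \<in> Z \<Longrightarrow> \<exists>k. c g = lead_coeff g ^ k" by metis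
  have c0: "e0 (c g) \<noteq> 0" if "g \<in> Z" for g
    using c[OF that] Z(2)[OF that] by (auto simp: ring_morphism_power[OF e0] surviving_def)
  define E where "E = insert p' ((\<lambda>g. trunc (r g)) ` {g\<in>Z. ev0 (r g) \<noteq> 0})"
  have "specializes (G \<union> E)"
  proof (rule IH)
    show "finite E" using Z by (simp add: E_def)
    fix f assume "f \<in> E"
    then consider "f = p'" | g where "g \<in> Z" "ev0 (r g) \<noteq> 0" "f = trunc (r g)"
      by (auto simp: E_def)
    then show "surviving f \<and> degree f < degree p"
    proof cases
      case 1
      with p' show ?thesis by simp
    next
      case 2
      then have "r g \<noteq> 0" by auto
      have "degree f \<le> degree (r g)"
        using degree_trunc[OF 2(2)] 2(3) map_poly_degree_leq[of e0 "r g"] by simp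
      also have "\<dots> < degree g" using deg_r[OF 2(1)] \<open>r g \<noteq> 0\<close> by simp
      also have "\<dots> \<le> degree p" using 2(1) deg p' by (auto simp: Z_def)
      finally show ?thesis using surviving_trunc[OF 2(2)] 2(3) by simp
    qed
  qed
  moreover have "eventually (\<lambda>a. \<forall>g\<in>Z. same_sign (e0 (c g)) (e a (c g)) \<and> ev a (trunc (r g)) = ev a (r g)) F"
    using Z(1) by (intro eventually_ball_finite ballI eventually_conj sign eventually_ev_trunc)
  moreover note ev_p' surviving_eventually[OF p(1)]
  ultimately show ?thesis unfolding specializes_def
  proof eventually_elim
    case (elim a)
    let ?P = "\<lambda>f. (ev0 f, ev a f)"
    from elim(1) obtain R where R: "same_diagram R (?P ` (G \<union> E))" by blast
    have RZ: "same_diagram R (?P ` Z)"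
      by (rule same_diagram_subset[OF R]) (auto simp: Z_def E_def)
    have "\<exists>S. same_diagram S (insert (ev0 p, ev a p) (?P ` Z))"
    proof (rule same_diagram_insert[OF RZ])
      show "(pderiv (ev0 p), pderiv (ev a p)) \<in> ?P ` Z"
        using ev0_p' elim(3) by (force simp: Z_def)
      show "degree (ev0 p) = degree (ev a p)" "ev0 p \<noteq> 0" "ev a p \<noteq> 0"
        "same_sign (lead_coeff (ev0 p)) (lead_coeff (ev a p))"
        using elim(4) surviving_degree[OF p(1)] by auto
    next
      fix g h u v
      assume "(g, h) \<in> ?P ` Z" and g: "poly g u = 0" and h: "poly h v = 0" and uv: "aligned R u v"
      then obtain f where f: "f \<in> Z" "g = ev0 f" "h = ev a f" by auto
      have r: "same_sign (poly (ev0 (r f)) u) (poly (ev a (r f)) v)"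
      proof (cases "ev0 (r f) = 0")
        case True
        then have "trunc (r f) = 0" by (intro poly_eqI) (simp add: coeff_trunc)
        then have "ev a (r f) = 0" using elim(2) f(1) by auto
        with True show ?thesis by (simp add: same_sign_def)
      next
        case False
        then have "?P (trunc (r f)) \<in> ?P ` (G \<union> E)" using f by (auto simp: E_def)
        from same_diagramD(1)[OF R this uv] show ?thesis
          using elim(2) f by (auto simp: ev0_trunc)
      qed
      have "poly (ev0 (smult (c f * c f) p)) u = poly (ev0 (f * q f + r f)) u"
        "poly (ev a (smult (c f * c f) p)) v = poly (ev a (f * q f + r f)) v"
        by (simp_all only: cqr[OF f(1)])
      then have *: "e0 (c f) * e0 (c f) * poly (ev0 p) u = poly (ev0 (r f)) u"
        "e a (c f) * e a (c f) * poly (ev a p) v = poly (ev a (r f)) v"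
        using g h f e0 e
        by (simp_all add: map_poly_smult ring_morphism_0 ring_morphism_mult ring_morphism_add map_poly_ring_morphism)
      have "e0 (c f) \<noteq> 0" "e a (c f) \<noteq> 0"
        using c0[OF f(1)] elim(2) f(1) by (auto dest: same_sign_0_iff)
      then have "0 < e0 (c f) * e0 (c f)" "0 < e a (c f) * e a (c f)"
        by (auto simp: zero_less_mult_iff linorder_neq_iff)
      with r show "same_sign (poly (ev0 p) u) (poly (ev a p) v)"
        unfolding *[symmetric] by (auto simp: same_sign_def zero_less_mult_iff mult_less_0_iff)
    qed
    then obtain S where "same_diagram S (insert (ev0 p, ev a p) (?P ` Z))" by blast
    then have "same_diagram S (?P ` insert p G)"
      by (rule same_diagram_subset) (auto simp: Z_def)
    then show ?case by blast
  qed
qed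

text \<open>
  The outer induction bounds the degree and the inner one runs over the polynomials of exactly
  the maximal degree.  The inner hypothesis must hold for arbitrary sets \<open>H\<close> of smaller degree, because derivative
  and remainders are added to \<open>H\<close>.
\<close>

lemma specializes_surviving:
  assumes "finite G" "\<And>f. f \<in> G \<Longrightarrow> surviving f \<and> degree f < d"
  shows "specializes G"
  using assms
proof (induction d arbitrary: G)
  case 0
  then have "G = {}" by auto
  then show ?case
    by (auto simp: specializes_def same_diagram_def matching_def intro!: always_eventually exI[of _ "{}"])
next
  case (Suc d)
  define H D where "H = {f\<in>G. degree f < d}" and "D = {f\<in>G. degree f = d}"
  have "finite D" "\<And>f. f \<in> D \<Longrightarrow> surviving f \<and> degree f = d" using Suc.prems by (auto simp: D_def)
  moreover have "finite H" "\<And>f. f \<in> H \<Longrightarrow> surviving f \<and> degree f < d" using Suc.prems by (auto simp: H_def)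
  ultimately have "specializes (H \<union> D)"
  proof (induction D arbitrary: H rule: finite_induct)
    case empty
    then show ?case using Suc.IH[of H] by simp
  next
    case (insert p D)
    have p: "surviving p" "degree p = d" using insert.prems(1)[of p] by auto
    show ?case
    proof (cases "d = 0")
      case True
      have "\<forall>f\<in>insert p D. eventually (\<lambda>a. same_sign (e0 (coeff f 0)) (e a (coeff f 0))) F"
        using sign by blast
      then have "eventually (\<lambda>a. \<forall>f\<in>insert p D. same_sign (e0 (coeff f 0)) (e a (coeff f 0))) F"
        using insert.hyps(1) by (intro eventually_ball_finite) auto
      then have "specializes (insert p D)"
        unfolding specializes_def
      proof eventually_elim
        case (elim a)
        have "same_diagram {} ((\<lambda>f. (ev0 f, ev a f)) ` insert p D)"
          unfolding same_diagram_def
        proof (intro conjI ballI)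
          show "matching {}" by (simp add: matching_def)
          fix s assume "s \<in> (\<lambda>f. (ev0 f, ev a f)) ` insert p D"
          then obtain f where f: "f \<in> insert p D" "s = (ev0 f, ev a f)" by blast
          then have "surviving f" "degree f = 0" using insert.prems(1) True by auto
          then obtain b where b: "f = [:b:]" by (auto elim: degree_eq_zeroE)
          have "e0 b \<noteq> 0" using \<open>surviving f\<close> by (simp add: surviving_def b)
          moreover have "same_sign (e0 b) (e a b)" using elim f b by auto
          moreover have "ev0 f = [:e0 b:]" "ev a f = [:e a b:]"
            by (simp_all add: b map_poly_pCons ring_morphism_0 e0 e)
          ultimately show "case s of (g, h) \<Rightarrow> (\<forall>u v. aligned {} u v \<longrightarrow> same_sign (poly g u) (poly h v)) \<and>
              (\<forall>u. poly g u = 0 \<longrightarrow> u \<in> fst ` {}) \<and> (\<forall>v. poly h v = 0 \<longrightarrow> v \<in> snd ` {})"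
            using f(2) by (auto dest: same_sign_0_iff)
        qed
        then show ?case by blast
      qed
      moreover have "H = {}" using insert.prems(3) True by auto
      ultimately show ?thesis by simp
    next
      case False
      have "specializes (insert p (H \<union> D))"
      proof (rule specializes_insert)
        show "finite (H \<union> D)" using insert by simp
        show "surviving g" if "g \<in> H \<union> D" for g using that insert.prems by blast
        show "surviving p" "0 < degree p" using p False by auto
        show "degree g \<le> degree p" if "g \<in> H \<union> D" for g
          using that insert.prems p by (metis UnE insertCI le_refl less_imp_le)
        fix E assume "finite E" "\<And>f. f \<in> E \<Longrightarrow> surviving f \<and> degree f < degree p"
        then have "specializes ((H \<union> E) \<union> D)"
          using insert.prems p by (intro insert.IH) auto
        then show "specializes (H \<union> D \<union> E)" by (simp add: Un_ac)
      qed
      then show ?thesis by simp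
    qed
  qed
  moreover have "H \<union> D = G" using Suc.prems(2) by (auto simp: H_def D_def less_Suc_eq)
  ultimately show ?case by simp
qed

text \<open>
  Any point aligned with \<open>u\<close> in a common diagram has the required signs.
\<close>

theorem eventually_realized:
  assumes "finite G"
  shows "eventually (\<lambda>a. \<exists>v. \<forall>f\<in>G. same_sign (poly (ev0 f) u) (poly (ev a f) v)) F"
proof -
  define G' where "G' = trunc ` {f\<in>G. ev0 f \<noteq> 0}"
  have fin: "finite G'" using assms by (simp add: G'_def)
  have "specializes G'"
  proof (rule specializes_surviving[OF fin])
    fix f assume "f \<in> G'"
    then show "surviving f \<and> degree f < Suc (Max (degree ` G'))"
      using fin by (auto simp: less_Suc_eq_le G'_def intro!: Max_ge surviving_trunc)
  qed
  moreover have "eventually (\<lambda>a. \<forall>f\<in>G. ev a (trunc f) = ev a f) F"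
    using assms by (intro eventually_ball_finite ballI eventually_ev_trunc)
  ultimately show ?thesis unfolding specializes_def
  proof eventually_elim
    case (elim a)
    then obtain R where R: "same_diagram R ((\<lambda>f. (ev0 f, ev a f)) ` G')" by blast
    then have "matching R" by (simp add: same_diagram_def)
    then obtain v where v: "aligned R u v" using matching_aligned_exists by blast
    have "same_sign (poly (ev0 f) u) (poly (ev a f) v)" if "f \<in> G" for f
    proof (cases "ev0 f = 0")
      case True
      then have "trunc f = 0" by (intro poly_eqI) (simp add: coeff_trunc)
      then have "ev a f = 0" using elim(2) that by auto
      with True show ?thesis by (simp add: same_sign_def)
    next
      case False
      then have "(ev0 (trunc f), ev a (trunc f)) \<in> (\<lambda>f. (ev0 f, ev a f)) ` G'"
        using that by (auto simp: G'_def)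
      from same_diagramD(1)[OF R this v] show ?thesis using elim(2) that by (simp add: ev0_trunc)
    qed
    then show ?case by blast
  qed
qed

end

section \<open>Multivariate polynomials and the transfer of signs to the reals\<close>

definition mpoly_eval :: "(real \<Rightarrow> 'a::comm_ring_1) \<Rightarrow> ('n::finite \<Rightarrow> 'a) \<Rightarrow> 'n rpoly \<Rightarrow> 'a" where
  "mpoly_eval h x f = (\<Sum>\<alpha>\<in>Poly_Mapping.keys f. h (Poly_Mapping.lookup f \<alpha>) * (\<Prod>i\<in>UNIV. x i ^ Poly_Mapping.lookup \<alpha> i))"

lemma rpoly_sum_monomials:
  fixes f :: "'n::finite rpoly"
  shows "f = (\<Sum>\<alpha>\<in>Poly_Mapping.keys f. Poly_Mapping.single \<alpha> (Poly_Mapping.lookup f \<alpha>))"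
  by (rule poly_mapping_eqI) (auto simp: lookup_sum lookup_single when_def in_keys_iff)

context
  fixes h :: "real \<Rightarrow> 'a::comm_ring_1" and x :: "'n::finite \<Rightarrow> 'a"
  assumes h: "ring_morphism h"
begin

lemma mpoly_eval_superset:
  assumes "finite A" "Poly_Mapping.keys f \<subseteq> A"
  shows "mpoly_eval h x f = (\<Sum>\<alpha>\<in>A. h (Poly_Mapping.lookup f \<alpha>) * (\<Prod>i\<in>UNIV. x i ^ Poly_Mapping.lookup \<alpha> i))"
  unfolding mpoly_eval_def using assms
  by (intro sum.mono_neutral_left) (auto simp: in_keys_iff ring_morphism_0[OF h])

lemma mpoly_eval_single:
  "mpoly_eval h x (Poly_Mapping.single \<alpha> r) = h r * (\<Prod>i\<in>UNIV. x i ^ Poly_Mapping.lookup \<alpha> i)"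
  by (simp add: mpoly_eval_def ring_morphism_0[OF h])

lemma mpoly_eval_add: "mpoly_eval h x (f + g) = mpoly_eval h x f + mpoly_eval h x g"
proof -
  let ?A = "Poly_Mapping.keys f \<union> Poly_Mapping.keys g"
  have "Poly_Mapping.keys (f + g) \<subseteq> ?A" by (rule Poly_Mapping.keys_add)
  then show ?thesis
    by (simp add: mpoly_eval_superset[of ?A] lookup_add ring_morphism_add[OF h] algebra_simps sum.distrib)
qed

lemma mpoly_eval_sum: "mpoly_eval h x (\<Sum>i\<in>A. f i) = (\<Sum>i\<in>A. mpoly_eval h x (f i))"
  by (induction A rule: infinite_finite_induct) (simp_all add: mpoly_eval_add, simp_all add: mpoly_eval_def)

lemma mpoly_eval_mult: "mpoly_eval h x (f * g) = mpoly_eval h x f * mpoly_eval h x g"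
proof -
  let ?s = "\<lambda>f \<alpha>. Poly_Mapping.single \<alpha> (Poly_Mapping.lookup f \<alpha>)"
  have single: "mpoly_eval h x (Poly_Mapping.single \<alpha> r * Poly_Mapping.single \<beta> s)
      = mpoly_eval h x (Poly_Mapping.single \<alpha> r) * mpoly_eval h x (Poly_Mapping.single \<beta> s)" for \<alpha> \<beta> r s
    by (simp add: mult_single mpoly_eval_single lookup_add power_add prod.distrib ring_morphism_mult[OF h] ac_simps)
  have "f * g = (\<Sum>\<alpha>\<in>Poly_Mapping.keys f. ?s f \<alpha>) * (\<Sum>\<beta>\<in>Poly_Mapping.keys g. ?s g \<beta>)"
    by (simp flip: rpoly_sum_monomials)
  also have "mpoly_eval h x \<dots> = (\<Sum>\<alpha>\<in>Poly_Mapping.keys f. mpoly_eval h x (?s f \<alpha>)) * (\<Sum>\<beta>\<in>Poly_Mapping.keys g. mpoly_eval h x (?s g \<beta>))"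
    by (simp add: sum_product mpoly_eval_sum single)
  also have "\<dots> = mpoly_eval h x f * mpoly_eval h x g"
    by (simp flip: mpoly_eval_sum rpoly_sum_monomials)
  finally show ?thesis .
qed

lemma ring_morphism_mpoly_eval: "ring_morphism (mpoly_eval h x)"
  unfolding ring_morphism_def
  by (auto simp: mpoly_eval_add mpoly_eval_mult mpoly_eval_single ring_morphism_1[OF h] simp flip: single_one)

end

text \<open>
  Recovers an abstract ring morphism as evaluation at the images of the variables, with
  coefficients mapped by the restriction of the morphism to the constants.
\<close>

lemma mpoly_eval_unique:
  fixes H :: "'n::finite rpoly \<Rightarrow> 'a::comm_ring_1"
  assumes "ring_morphism H"
  shows "H f = mpoly_eval (\<lambda>r. H (Poly_Mapping.single 0 r)) (\<lambda>i. H (Poly_Mapping.single (Poly_Mapping.single i 1) 1)) f"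
proof -
  have mono: "H (Poly_Mapping.single \<alpha> 1) = (\<Prod>i\<in>UNIV. H (Poly_Mapping.single (Poly_Mapping.single i 1) 1) ^ Poly_Mapping.lookup \<alpha> i)"
    for \<alpha> :: "'n monom"
  proof -
    have power: "Poly_Mapping.single (Poly_Mapping.single i 1) (1::real) ^ k = Poly_Mapping.single (Poly_Mapping.single i k) 1" for i :: 'n and k
      by (induction k) (simp_all add: mult_single single_one flip: single_add)
    have prod: "(\<Prod>i\<in>A. Poly_Mapping.single (\<beta> i) (1::real)) = Poly_Mapping.single (\<Sum>i\<in>A. \<beta> i) 1" for A and \<beta> :: "'n \<Rightarrow> 'n monom"
      by (induction A rule: infinite_finite_induct) (simp_all add: mult_single single_one)
    have "(\<Sum>i\<in>UNIV. Poly_Mapping.single i (Poly_Mapping.lookup \<alpha> i)) = \<alpha>"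
      by (rule poly_mapping_eqI) (simp add: lookup_sum lookup_single when_def)
    then have "Poly_Mapping.single \<alpha> (1::real) =
        (\<Prod>i\<in>UNIV. Poly_Mapping.single (Poly_Mapping.single i 1) 1 ^ Poly_Mapping.lookup \<alpha> i)"
      by (simp only: power prod)
    then show ?thesis
      by (simp only: ring_morphism_prod[OF assms] ring_morphism_power[OF assms])
  qed
  have "H f = (\<Sum>\<alpha>\<in>Poly_Mapping.keys f. H (Poly_Mapping.single \<alpha> (Poly_Mapping.lookup f \<alpha>)))"
    by (subst rpoly_sum_monomials) (rule ring_morphism_sum[OF assms])
  also have "\<dots> = (\<Sum>\<alpha>\<in>Poly_Mapping.keys f. H (Poly_Mapping.single 0 (Poly_Mapping.lookup f \<alpha>)) * H (Poly_Mapping.single \<alpha> 1))"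
    by (simp add: mult_single flip: ring_morphism_mult[OF assms])
  also have "\<dots> = mpoly_eval (\<lambda>r. H (Poly_Mapping.single 0 r)) (\<lambda>i. H (Poly_Mapping.single (Poly_Mapping.single i 1) 1)) f"
    unfolding mpoly_eval_def by (intro sum.cong refl arg_cong2[where f = "(*)"] mono)
  finally show ?thesis .
qed

text \<open>
  The polynomial \<open>f\<close> regarded as a polynomial in the variable \<open>i\<close>.  The coefficients still
  contain powers of this variable; they disappear when it is set to \<open>1\<close>, as in
  \<open>poly_separate_var\<close>, so no separate ring of polynomials in the other variables is needed.
\<close>

definition separate_var :: "'n::finite \<Rightarrow> 'n rpoly \<Rightarrow> 'n rpoly poly" where
  "separate_var i f = (\<Sum>\<alpha>\<in>Poly_Mapping.keys f. monom (Poly_Mapping.single \<alpha> (Poly_Mapping.lookup f \<alpha>)) (Poly_Mapping.lookup \<alpha> i))"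

lemma poly_separate_var:
  assumes h: "ring_morphism h" and "x i = 1"
  shows "poly (map_poly (mpoly_eval h x) (separate_var i f)) v = mpoly_eval h (x(i := v)) f"
proof -
  note H = ring_morphism_mpoly_eval[OF h, of x]
  have prod: "(\<Prod>j\<in>UNIV. x j ^ Poly_Mapping.lookup \<alpha> j) * v ^ Poly_Mapping.lookup \<alpha> i
      = (\<Prod>j\<in>UNIV. (x(i := v)) j ^ Poly_Mapping.lookup \<alpha> j)" for \<alpha>
    using assms(2) by (simp add: prod.remove[of UNIV i] mult.commute)
  show ?thesis
    by (simp add: separate_var_def ring_morphism_sum[OF map_poly_ring_morphism[OF H]] poly_sum
        map_poly_monom ring_morphism_0[OF H] poly_monom mpoly_eval_single[OF h] mult.assoc prod
        del: fun_upd_apply) (simp add: mpoly_eval_def)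
qed

text \<open>
  The variables outside \<open>S\<close> are held at \<open>1\<close>, and the induction on \<open>S\<close> releases them one by one.  By
  the induction hypothesis the conditions "the signs of these finitely many polynomials are right" generate a
  proper filter on the real points, and \<open>eventually_realized\<close> then supplies a value for the next variable.
\<close>

theorem signs_realized_over_reals:
  fixes h :: "real \<Rightarrow> 'k::real_closed_field" and c :: "'n::finite \<Rightarrow> 'k"
  assumes h: "ring_morphism h" and "finite C"
  shows "\<exists>a::'n \<Rightarrow> real. \<forall>f\<in>C. same_sign (mpoly_eval h c f) (mpoly_eval id a f)"
proof -
  have id: "ring_morphism (id :: real \<Rightarrow> real)" by (simp add: ring_morphism_def)
  define c' where "c' S = (\<lambda>i. if i \<in> S then c i else 1)" for S
  have "\<exists>a. (\<forall>i. i \<notin> S \<longrightarrow> a i = 1) \<and> (\<forall>f\<in>C. same_sign (mpoly_eval h (c' S) f) (mpoly_eval id a f))"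
    if "finite C" for S and C :: "'n rpoly set"
    using finite[of S] that
  proof (induction S arbitrary: C rule: finite_induct)
    case empty
    have const: "mpoly_eval g (\<lambda>_. 1) f = g (\<Sum>\<alpha>\<in>Poly_Mapping.keys f. Poly_Mapping.lookup f \<alpha>)"
      if "ring_morphism g" for g :: "real \<Rightarrow> 'b::comm_ring_1" and f :: "'n rpoly"
      by (simp add: mpoly_eval_def ring_morphism_sum[OF that])
    \<comment> \<open>Positive reals are squares, so the morphism preserves the order.\<close>
    have pos: "0 < h r" if "0 < r" for r
    proof -
      have "h r = h (sqrt r) * h (sqrt r)" using that by (simp flip: ring_morphism_mult[OF h])
      moreover have "h (sqrt r) * h (inverse (sqrt r)) = 1"
        using that by (simp add: ring_morphism_1[OF h] flip: ring_morphism_mult[OF h])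
      then have "h (sqrt r) \<noteq> 0" by auto
      ultimately show ?thesis by (auto simp: zero_less_mult_iff linorder_neq_iff)
    qed
    have "same_sign (h r) r" for r
      using pos[of r] pos[of "- r"] ring_morphism_uminus[OF h, of r] ring_morphism_0[OF h]
      by (cases r "0::real" rule: linorder_cases) (auto simp: same_sign_def)
    then have "same_sign (h r) (id r)" for r by simp
    then have "same_sign (mpoly_eval h (\<lambda>_. 1) f) (mpoly_eval id (\<lambda>_. 1) f)" for f :: "'n rpoly"
      by (simp only: const[OF h] const[OF id])
    then show ?case
      by (intro exI[of _ "\<lambda>_. 1"]) (simp only: c'_def empty_iff if_False simp_thms ball_triv)
  next
    case (insert i S)
    define F where "F = (INF f. principal {a. (\<forall>j. j \<notin> S \<longrightarrow> a j = 1) \<and>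
        same_sign (mpoly_eval h (c' S) f) (mpoly_eval id a f)})"
    have ev: "eventually (\<lambda>a. (\<forall>j. j \<notin> S \<longrightarrow> a j = 1) \<and> same_sign (mpoly_eval h (c' S) f) (mpoly_eval id a f)) F" for f
      unfolding F_def by (rule eventually_INF1[of f]) (simp_all add: eventually_principal)
    have "F \<noteq> bot"
      unfolding F_def
    proof (rule INF_filter_not_bot)
      fix A :: "'n rpoly set"
      assume "finite A"
      from insert.IH[OF this] obtain a where a: "\<forall>j. j \<notin> S \<longrightarrow> a j = 1"
          "\<forall>f\<in>A. same_sign (mpoly_eval h (c' S) f) (mpoly_eval id a f)" by blast
      let ?A = "\<lambda>f. {a. (\<forall>j. j \<notin> S \<longrightarrow> a j = 1) \<and> same_sign (mpoly_eval h (c' S) f) (mpoly_eval id a f)}"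
      have "a \<in> (\<Inter>f\<in>A. ?A f)" using a by blast
      then have "(\<Inter>f\<in>A. ?A f) \<noteq> {}" by blast
      then show "(INF f\<in>A. principal (?A f)) \<noteq> bot"
        unfolding INF_principal_finite[OF \<open>finite A\<close>] principal_eq_bot_iff .
    qed
    interpret sign_specialization "mpoly_eval h (c' S)" "mpoly_eval (id :: real \<Rightarrow> real)" F
    proof
      show "eventually (\<lambda>a. same_sign (mpoly_eval h (c' S) f) (mpoly_eval id a f)) F" for f
        using ev[of f] by (rule eventually_mono) simp
    qed (auto intro: ring_morphism_mpoly_eval h id)
    have "eventually (\<lambda>a. \<exists>v. \<forall>f\<in>separate_var i ` C.
        same_sign (poly (ev0 f) (c i)) (poly (ev a f) v)) F"
      using insert.prems by (intro eventually_realized) auto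
    with ev[of 0] have "eventually (\<lambda>a. (\<forall>j. j \<notin> S \<longrightarrow> a j = 1) \<and> (\<exists>v. \<forall>f\<in>separate_var i ` C.
        same_sign (poly (ev0 f) (c i)) (poly (ev a f) v))) F"
      by eventually_elim auto
    from eventually_happens'[OF \<open>F \<noteq> bot\<close> this] obtain a v where a: "\<And>j. j \<notin> S \<Longrightarrow> a j = 1"
      and v: "\<And>f. f \<in> C \<Longrightarrow> same_sign (poly (ev0 (separate_var i f)) (c i)) (poly (ev a (separate_var i f)) v)"
      by auto
    have c': "(c' S)(i := c i) = c' (insert i S)" "c' S i = 1" using insert.hyps(2) by (auto simp: c'_def)
    have "\<forall>f\<in>C. same_sign (mpoly_eval h (c' (insert i S)) f) (mpoly_eval id (a(i := v)) f)"
    proof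
      fix f assume "f \<in> C"
      from v[OF this] show "same_sign (mpoly_eval h (c' (insert i S)) f) (mpoly_eval id (a(i := v)) f)"
        by (simp only: poly_separate_var[where i = i and x = "c' S", OF h c'(2)] poly_separate_var[where i = i and x = a, OF id a[OF insert.hyps(2)]] c'(1))
    qed
    moreover have "\<forall>j. j \<notin> insert i S \<longrightarrow> (a(i := v)) j = 1" using a by auto
    ultimately show ?case by blast
  qed
  from this[OF assms(2), of UNIV] show ?thesis by (auto simp: c'_def)
qed

section \<open>The real closure of an ordered field\<close>

text \<open>
  Positive cones of formally real subfields: the elements \<open>x - y\<close> with \<open>x\<close> and \<open>y\<close> in \<open>T\<close> form a field
  (\<open>cone_field\<close>), of which \<open>T\<close> contains all squares.  As the cone determines the field, a single application of Zorn's lemma enlarges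
  the field and its ordering at the same time.
\<close>

definition field_cone :: "'a::field set \<Rightarrow> bool" where
  "field_cone T \<longleftrightarrow> 0 \<in> T \<and> 1 \<in> T \<and> (\<forall>x\<in>T. \<forall>y\<in>T. x + y \<in> T \<and> x * y \<in> T) \<and>
     (\<forall>x\<in>T. inverse x \<in> T) \<and> (\<forall>x\<in>T. \<forall>y\<in>T. (x - y) * (x - y) \<in> T) \<and> - 1 \<notin> T"

lemma field_coneD:
  assumes "field_cone T"
  shows "0 \<in> T" "1 \<in> T" "x \<in> T \<Longrightarrow> y \<in> T \<Longrightarrow> x + y \<in> T" "x \<in> T \<Longrightarrow> y \<in> T \<Longrightarrow> x * y \<in> T"
    "x \<in> T \<Longrightarrow> inverse x \<in> T" "x \<in> T \<Longrightarrow> y \<in> T \<Longrightarrow> (x - y) * (x - y) \<in> T" "- 1 \<notin> T"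
  using assms by (auto simp: field_cone_def)

lemma field_cone_maximal:
  assumes "field_cone T0"
  shows "\<exists>T. field_cone T \<and> T0 \<subseteq> T \<and> (\<forall>S. field_cone S \<longrightarrow> T \<subseteq> S \<longrightarrow> S = T)"
proof -
  have "\<exists>T\<in>{T. field_cone T \<and> T0 \<subseteq> T}. \<forall>S\<in>{T. field_cone T \<and> T0 \<subseteq> T}. T \<subseteq> S \<longrightarrow> S = T"
  proof (rule subset_Zorn_nonempty)
    show "{T. field_cone T \<and> T0 \<subseteq> T} \<noteq> {}" using assms by blast
    fix Ch assume Ch: "Ch \<noteq> {}" "subset.chain {T. field_cone T \<and> T0 \<subseteq> T} Ch"
    have cone: "field_cone T" "T0 \<subseteq> T" if "T \<in> Ch" for T
      using Ch(2) that unfolding subset_chain_def by blast+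
    have comparable: "A \<subseteq> B \<or> B \<subseteq> A" if "A \<in> Ch" "B \<in> Ch" for A B
      using Ch(2) that unfolding subset_chain_def by blast
    have both: "\<exists>T\<in>Ch. x \<in> T \<and> y \<in> T" if xy: "x \<in> \<Union>Ch" "y \<in> \<Union>Ch" for x y
    proof -
      obtain A where A: "A \<in> Ch" "x \<in> A" using xy(1) by blast
      obtain B where B: "B \<in> Ch" "y \<in> B" using xy(2) by blast
      show ?thesis using comparable[OF A(1) B(1)] A B by blast
    qed
    have "field_cone (\<Union>Ch)"
      unfolding field_cone_def
    proof (intro conjI ballI)
      show "0 \<in> \<Union>Ch" "1 \<in> \<Union>Ch" using Ch(1) cone(1)[THEN field_coneD(1)] cone(1)[THEN field_coneD(2)] by auto
      show "- 1 \<notin> \<Union>Ch" using cone(1)[THEN field_coneD(7)] by blast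
      fix x assume x: "x \<in> \<Union>Ch"
      then show "inverse x \<in> \<Union>Ch" using cone(1)[THEN field_coneD(5)] by blast
      fix y assume "y \<in> \<Union>Ch"
      then obtain T where T: "T \<in> Ch" "x \<in> T" "y \<in> T" using both x by blast
      note D = field_coneD[OF cone(1)[OF T(1)]]
      show "x + y \<in> \<Union>Ch" "x * y \<in> \<Union>Ch" "(x - y) * (x - y) \<in> \<Union>Ch"
        using D(3,4,6)[OF T(2,3)] T(1) by blast+
    qed
    moreover have "T0 \<subseteq> \<Union>Ch" using Ch(1) cone(2) by blast
    ultimately show "\<Union>Ch \<in> {T. field_cone T \<and> T0 \<subseteq> T}" by blast
  qed
  then obtain T where T: "field_cone T" "T0 \<subseteq> T"
    and max: "\<And>S. field_cone S \<and> T0 \<subseteq> S \<Longrightarrow> T \<subseteq> S \<Longrightarrow> S = T" by auto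
  have "\<forall>S. field_cone S \<longrightarrow> T \<subseteq> S \<longrightarrow> S = T"
    using max order_trans[OF T(2)] by blast
  with T show ?thesis by blast
qed

definition cone_field :: "'a::field set \<Rightarrow> 'a set" where
  "cone_field T = {x - y | x y. x \<in> T \<and> y \<in> T}"

context
  fixes T :: "'a::field set"
  assumes T: "field_cone T"
begin

lemmas cone_rules = field_coneD[OF T]

lemma cone_fieldI: "x \<in> T \<Longrightarrow> y \<in> T \<Longrightarrow> x - y \<in> cone_field T"
  by (auto simp: cone_field_def)

lemma cone_field_of_cone: "x \<in> T \<Longrightarrow> x \<in> cone_field T"
  using cone_fieldI[of x 0] cone_rules(1) by simp

lemma cone_field_closed:
  assumes "a \<in> cone_field T" "b \<in> cone_field T"
  shows "a + b \<in> cone_field T" "a - b \<in> cone_field T" "a * b \<in> cone_field T" "- a \<in> cone_field T"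
    "a * a \<in> T" "inverse a \<in> cone_field T"
proof -
  from assms obtain x y u v where ab: "a = x - y" "b = u - v" "x \<in> T" "y \<in> T" "u \<in> T" "v \<in> T"
    by (auto simp: cone_field_def)
  have "(x + u) - (y + v) \<in> cone_field T" "(x + v) - (y + u) \<in> cone_field T"
    "(x * u + y * v) - (x * v + y * u) \<in> cone_field T" "y - x \<in> cone_field T"
    by (intro cone_fieldI cone_rules(3,4) ab(3-6))+
  then show "a + b \<in> cone_field T" "a - b \<in> cone_field T" "a * b \<in> cone_field T" "- a \<in> cone_field T"
    by (simp_all add: ab(1,2) algebra_simps)
  show sq: "a * a \<in> T" unfolding ab(1) using ab cone_rules(6) by blast
  have "inverse a = x * inverse (a * a) - y * inverse (a * a)"
    using ab(1) by (cases "a = 0") (simp_all add: field_simps)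
  moreover have "x * inverse (a * a) - y * inverse (a * a) \<in> cone_field T"
    by (intro cone_fieldI cone_rules(4,5) ab(3,4) sq)
  ultimately show "inverse a \<in> cone_field T" by simp
qed

lemma cone_zero_sum: "x \<in> T \<Longrightarrow> - x \<in> T \<Longrightarrow> x = 0"
proof (rule ccontr)
  assume x: "x \<in> T" "- x \<in> T" "x \<noteq> 0"
  then have "(- x) * inverse x \<in> T" using cone_rules(4,5) by blast
  then show False using x(3) cone_rules(7) by simp
qed

text \<open>
  If \<open>- a\<close> is not in \<open>T\<close>, adjoining it gives a larger set \<open>S\<close> that is closed under the operations, so by maximality
  \<open>- 1 = s - a * t\<close> for some \<open>s\<close> and \<open>t\<close> in \<open>T\<close>.  Then \<open>a = (1 + s) / t\<close> is in \<open>T\<close>.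
\<close>

lemma maximal_cone_total:
  assumes max: "\<And>S. field_cone S \<Longrightarrow> T \<subseteq> S \<Longrightarrow> S = T" and a: "a \<in> cone_field T"
  shows "a \<in> T \<or> - a \<in> T"
proof (rule ccontr)
  assume neg: "\<not> ?thesis"
  define S where "S = {s - a * t | s t. s \<in> T \<and> t \<in> T}"
  have TS: "T \<subseteq> S" using cone_rules(1) by (force simp: S_def)
  have S_field: "S \<subseteq> cone_field T"
    using a cone_field_closed cone_field_of_cone by (auto simp: S_def)
  have S_mult: "x * y \<in> S" if xy: "x \<in> S" "y \<in> S" for x y
  proof -
    from xy obtain s t s' t' where *: "x = s - a * t" "y = s' - a * t'" "s \<in> T" "t \<in> T" "s' \<in> T" "t' \<in> T"
      by (auto simp: S_def)
    have "x * y = (s * s' + a * a * (t * t')) - a * (s * t' + s' * t)"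
      by (simp add: * algebra_simps)
    moreover have "s * s' + a * a * (t * t') \<in> T" "s * t' + s' * t \<in> T"
      using * cone_field_closed(5)[OF a a] cone_rules(3,4) by auto
    ultimately show ?thesis unfolding S_def by blast
  qed
  have "field_cone S"
    unfolding field_cone_def
  proof (intro conjI ballI)
    show "0 \<in> S" "1 \<in> S" using TS cone_rules by auto
    fix x assume x: "x \<in> S"
    have inv: "inverse x = x * (inverse x * inverse x)" by (cases "x = 0") (simp_all add: field_simps)
    have "inverse x * inverse x \<in> T"
      using cone_field_closed(5)[OF cone_field_closed(6) cone_field_closed(6)] x S_field by (meson subsetD)
    then have "x * (inverse x * inverse x) \<in> S" using S_mult[OF x] TS by blast
    then show "inverse x \<in> S" by (subst inv)
    fix y assume y: "y \<in> S"
    show "x * y \<in> S" using S_mult x y .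
    have d: "x - y \<in> cone_field T" using cone_field_closed(2) x y S_field by (meson subsetD)
    from cone_field_closed(5)[OF d d] TS show "(x - y) * (x - y) \<in> S" by (rule subsetD[rotated])
    from x y obtain s t s' t' where *: "x = s - a * t" "y = s' - a * t'" "s \<in> T" "t \<in> T" "s' \<in> T" "t' \<in> T"
      by (auto simp: S_def)
    have "x + y = (s + s') - a * (t + t')" by (simp add: * algebra_simps)
    then show "x + y \<in> S" unfolding S_def using * cone_rules(3) by blast
  next
    show "- 1 \<notin> S"
    proof
      assume "- 1 \<in> S"
      then obtain s t where st: "- 1 = s - a * t" "s \<in> T" "t \<in> T" by (auto simp: S_def)
      have at: "a * t = 1 + s" using st(1) by (simp add: algebra_simps)
      have "t \<noteq> 0"
      proof
        assume "t = 0"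
        with st have "- 1 \<in> T" by simp
        with cone_rules(7) show False by simp
      qed
      then have "a = (1 + s) * inverse t" using at by (simp add: field_simps)
      then have "a \<in> T" using st cone_rules(2,3,4,5) by auto
      with neg show False by simp
    qed
  qed
  from max[OF this TS] have "S = T" .
  moreover have "0 - a * 1 \<in> S" using cone_rules(1,2) unfolding S_def by blast
  ultimately show False using neg by simp
qed

end

definition closure_cone :: "'a::linordered_field alg_closure set" where
  "closure_cone = (SOME T. field_cone T \<and> to_ac ` {0..} \<subseteq> T \<and> (\<forall>S. field_cone S \<longrightarrow> T \<subseteq> S \<longrightarrow> S = T))"

lemma closure_cone:
  "field_cone (closure_cone :: 'a::linordered_field alg_closure set)"
  "to_ac ` {0..} \<subseteq> (closure_cone :: 'a alg_closure set)"
  "\<And>S. field_cone S \<Longrightarrow> (closure_cone :: 'a alg_closure set) \<subseteq> S \<Longrightarrow> S = closure_cone"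
proof -
  have "field_cone (to_ac ` {0::'a..})"
    unfolding field_cone_def
  proof (intro conjI ballI)
    show "0 \<in> to_ac ` {0::'a..}" "1 \<in> to_ac ` {0::'a..}"
      by (auto intro!: image_eqI[where x = 0] image_eqI[where x = 1])
    show "- 1 \<notin> to_ac ` {0::'a..}"
    proof
      assume "- 1 \<in> to_ac ` {0::'a..}"
      then obtain x :: 'a where "0 \<le> x" "to_ac x = to_ac (- 1)" by force
      then have "x = - 1" by (simp only: to_ac_eq_iff)
      with \<open>0 \<le> x\<close> show False by simp
    qed
    fix x assume "x \<in> to_ac ` {0::'a..}"
    then obtain x' :: 'a where x': "0 \<le> x'" "x = to_ac x'" by auto
    then show "inverse x \<in> to_ac ` {0::'a..}" by (auto simp flip: to_ac_inverse)
    fix y assume "y \<in> to_ac ` {0::'a..}"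
    then obtain y' :: 'a where "0 \<le> y'" "y = to_ac y'" by auto
    with x' show "x + y \<in> to_ac ` {0::'a..}" "x * y \<in> to_ac ` {0::'a..}" "(x - y) * (x - y) \<in> to_ac ` {0::'a..}"
      by (auto simp flip: to_ac_add to_ac_mult to_ac_diff)
  qed
  from field_cone_maximal[OF this] have "\<exists>T. field_cone T \<and> to_ac ` {0::'a..} \<subseteq> T \<and> (\<forall>S. field_cone S \<longrightarrow> T \<subseteq> S \<longrightarrow> S = T)" .
  from someI_ex[OF this] have *: "field_cone (closure_cone :: 'a alg_closure set) \<and>
      to_ac ` {0..} \<subseteq> (closure_cone :: 'a alg_closure set) \<and>
      (\<forall>S. field_cone S \<longrightarrow> (closure_cone :: 'a alg_closure set) \<subseteq> S \<longrightarrow> S = closure_cone)"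
    unfolding closure_cone_def .
  then show "field_cone (closure_cone :: 'a alg_closure set)"
    "to_ac ` {0..} \<subseteq> (closure_cone :: 'a alg_closure set)" by blast+
  show "S = closure_cone" if "field_cone S" "closure_cone \<subseteq> S" for S :: "'a alg_closure set"
    using * that by blast
qed

typedef (overloaded) 'a::linordered_field real_closure =
  "cone_field (closure_cone :: 'a alg_closure set)"
  using cone_field_of_cone[OF closure_cone(1)] field_coneD(1)[OF closure_cone(1)] by blast

setup_lifting type_definition_real_closure

instantiation real_closure :: (linordered_field) field
begin

lift_definition zero_real_closure :: "'a real_closure" is 0
  by (intro cone_field_of_cone closure_cone field_coneD(1))
lift_definition one_real_closure :: "'a real_closure" is 1
  by (intro cone_field_of_cone closure_cone field_coneD(2))
lift_definition plus_real_closure :: "'a real_closure \<Rightarrow> 'a real_closure \<Rightarrow> 'a real_closure" is "(+)"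
  by (rule cone_field_closed(1)[OF closure_cone(1)])
lift_definition minus_real_closure :: "'a real_closure \<Rightarrow> 'a real_closure \<Rightarrow> 'a real_closure" is "(-)"
  by (rule cone_field_closed(2)[OF closure_cone(1)])
lift_definition times_real_closure :: "'a real_closure \<Rightarrow> 'a real_closure \<Rightarrow> 'a real_closure" is "(*)"
  by (rule cone_field_closed(3)[OF closure_cone(1)])
lift_definition uminus_real_closure :: "'a real_closure \<Rightarrow> 'a real_closure" is uminus
  by (rule cone_field_closed(4)[OF closure_cone(1)])
lift_definition inverse_real_closure :: "'a real_closure \<Rightarrow> 'a real_closure" is inverse
  by (rule cone_field_closed(6)[OF closure_cone(1)])
definition divide_real_closure :: "'a real_closure \<Rightarrow> 'a real_closure \<Rightarrow> 'a real_closure" where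
  "divide_real_closure x y = x * inverse y"

instance
  by (standard; (unfold divide_real_closure_def)?; transfer; simp add: algebra_simps)

end

instantiation real_closure :: (linordered_field) linordered_field
begin

lift_definition less_eq_real_closure :: "'a real_closure \<Rightarrow> 'a real_closure \<Rightarrow> bool"
  is "\<lambda>x y. y - x \<in> closure_cone" .
definition less_real_closure :: "'a real_closure \<Rightarrow> 'a real_closure \<Rightarrow> bool" where
  "less_real_closure x y \<longleftrightarrow> x \<le> y \<and> \<not> y \<le> x"
definition abs_real_closure :: "'a real_closure \<Rightarrow> 'a real_closure" where
  "abs_real_closure x = (if x < 0 then - x else x)"
definition sgn_real_closure :: "'a real_closure \<Rightarrow> 'a real_closure" where
  "sgn_real_closure x = (if x = 0 then 0 else if 0 < x then 1 else - 1)"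

instance
proof
  fix x y z :: "'a real_closure"
  note D = field_coneD[OF closure_cone(1)]
  show "x \<le> x" by transfer (simp add: D(1))
  show trans: "x \<le> z" if "x \<le> y" "y \<le> z"
    using that
  proof transfer
    fix x y z :: "'a alg_closure"
    assume "y - x \<in> closure_cone" "z - y \<in> closure_cone"
    from D(3)[OF this] show "z - x \<in> closure_cone" by simp
  qed
  show antisym: "x = y" if "x \<le> y" "y \<le> x" for x y :: "'a real_closure"
    using that
  proof transfer
    fix x y :: "'a alg_closure"
    assume "y - x \<in> closure_cone" "x - y \<in> closure_cone"
    then show "x = y" using cone_zero_sum[OF closure_cone(1), of "y - x"] by simp
  qed
  show "(x < y) = (x \<le> y \<and> \<not> y \<le> x)" by (rule less_real_closure_def)
  show "x \<le> y \<or> y \<le> x"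
  proof transfer
    fix x y :: "'a alg_closure"
    assume "x \<in> cone_field closure_cone" "y \<in> cone_field closure_cone"
    then have "y - x \<in> cone_field closure_cone" using cone_field_closed(2)[OF closure_cone(1)] by blast
    from maximal_cone_total[OF closure_cone(1,3) this] show "y - x \<in> closure_cone \<or> x - y \<in> closure_cone" by simp
  qed
  show "z + x \<le> z + y" if "x \<le> y" using that by transfer simp
  have mult: "0 \<le> x * y" if "0 \<le> x" "0 \<le> y" for x y :: "'a real_closure"
    using that by transfer (simp add: D(4))
  have diff: "x \<le> y \<longleftrightarrow> 0 \<le> y - x" for x y :: "'a real_closure" by transfer simp
  show "z * x < z * y" if "x < y" "0 < z"
  proof -
    have xy: "0 \<le> y - x" "x \<noteq> y" "0 \<le> z" "z \<noteq> 0"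
      using that diff[of x y] by (auto simp: less_real_closure_def)
    then have "z * x \<le> z * y" using mult[of z "y - x"] unfolding diff[of "z * x"] by (simp add: right_diff_distrib)
    moreover have "z * x \<noteq> z * y" using xy by simp
    ultimately show ?thesis
      unfolding less_real_closure_def using antisym by blast
  qed
  show "\<bar>x\<bar> = (if x < 0 then - x else x)" by (rule abs_real_closure_def)
  show "sgn x = (if x = 0 then 0 else if 0 < x then 1 else - 1)" by (rule sgn_real_closure_def)
qed

end

lemma ring_morphism_Rep_real_closure: "ring_morphism (Rep_real_closure :: 'a::linordered_field real_closure \<Rightarrow> _)"
  by (simp add: ring_morphism_def one_real_closure.rep_eq plus_real_closure.rep_eq times_real_closure.rep_eq)

text \<open>
  A nonzero element of least degree in the ideal generated by \<open>f\<close> and \<open>g\<close>.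
\<close>

lemma poly_bezout:
  fixes f g :: "'a::field poly"
  assumes "f \<noteq> 0"
  shows "\<exists>m u v. m = u * g + v * f \<and> m \<noteq> 0 \<and> m dvd f \<and> m dvd g"
proof -
  define J where "J = {u * g + v * f | u v. True}"
  have J_add: "s * x + t * y \<in> J" if "x \<in> J" "y \<in> J" for s t x y
  proof -
    from that obtain u v u' v' where "x = u * g + v * f" "y = u' * g + v' * f" by (auto simp: J_def)
    then have "s * x + t * y = (s * u + t * u') * g + (s * v + t * v') * f" by (simp add: algebra_simps)
    then show ?thesis unfolding J_def by blast
  qed
  have f: "f \<in> J" unfolding J_def by (intro CollectI exI[of _ 0] exI[of _ 1]) simp
  have g: "g \<in> J" unfolding J_def by (intro CollectI exI[of _ 0] exI[of _ 1]) simp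
  obtain m where m: "m \<in> J \<and> m \<noteq> 0" and min: "\<And>x. x \<in> J \<and> x \<noteq> 0 \<Longrightarrow> degree m \<le> degree x"
    using ex_has_least_nat[of "\<lambda>x. x \<in> J \<and> x \<noteq> 0" f degree] f assms by blast
  have "m dvd x" if "x \<in> J" for x
  proof (rule ccontr)
    assume "\<not> m dvd x"
    then have nz: "x mod m \<noteq> 0" by (simp add: dvd_eq_mod_eq_0)
    have "x mod m = 1 * x + (- (x div m)) * m" by (simp add: minus_div_mult_eq_mod[symmetric])
    then have "x mod m \<in> J" using J_add[OF that, of m] m by metis
    with min nz have "degree m \<le> degree (x mod m)" by blast
    with degree_mod_less[of m x] m nz show False by auto
  qed
  with f g m show ?thesis by (auto simp: J_def)
qed

text \<open>
  Their values at a root \<open>\<beta>\<close> form the smallest candidate for a positive cone on the field generated by \<open>\<beta>\<close>.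
\<close>

inductive_set weighted_squares :: "'a::linordered_field poly set" where
  zero: "0 \<in> weighted_squares"
| add_square: "0 \<le> t \<Longrightarrow> s \<in> weighted_squares \<Longrightarrow> smult t (g * g) + s \<in> weighted_squares"

lemma weighted_squares_square: "0 \<le> t \<Longrightarrow> smult t (g * g) \<in> weighted_squares"
  using weighted_squares.add_square[OF _ weighted_squares.zero] by simp

lemma weighted_squares_add:
  "s \<in> weighted_squares \<Longrightarrow> s' \<in> weighted_squares \<Longrightarrow> s + s' \<in> weighted_squares"
  by (induction rule: weighted_squares.induct) (auto simp: add.assoc intro: weighted_squares.add_square)

lemma weighted_squares_mult:
  assumes "s \<in> weighted_squares" "s' \<in> weighted_squares"
  shows "s * s' \<in> weighted_squares"
  using assms(1)
proof induction
  case zero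
  then show ?case by (simp add: weighted_squares.zero)
next
  case (add_square t s g)
  have "smult t (g * g) * s' \<in> weighted_squares"
    using assms(2)
  proof induction
    case zero
    then show ?case by (simp add: weighted_squares.zero)
  next
    case (add_square t' s' g')
    have "smult t (g * g) * (smult t' (g' * g') + s') = smult (t * t') ((g * g') * (g * g')) + smult t (g * g) * s'"
      by (simp add: algebra_simps)
    then show ?case using weighted_squares.add_square[of "t * t'"] add_square \<open>0 \<le> t\<close> by simp
  qed
  then show ?case using add_square.IH by (simp add: distrib_right weighted_squares_add)
qed

text \<open>
  Reducing each squared polynomial modulo \<open>f\<close> bounds the degree and keeps the sum nonnegative.
\<close>

lemma weighted_squares_mod:
  assumes "s \<in> weighted_squares" "0 < degree f"
  shows "\<exists>s'. f dvd s - s' \<and> degree s' \<le> 2 * (degree f - 1) \<and> (\<forall>x. 0 \<le> poly s' x)"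
  using assms(1)
proof induction
  case zero
  then show ?case by (intro exI[of _ 0]) simp
next
  case (add_square t s g)
  then obtain s' where s': "f dvd s - s'" "degree s' \<le> 2 * (degree f - 1)" "\<forall>x. 0 \<le> poly s' x" by blast
  define r where "r = g mod f"
  have "f dvd g - r" by (simp add: r_def mod_eq_dvd_iff[symmetric])
  then have "f dvd smult t ((g - r) * (g + r)) + (s - s')"
    using s'(1) by (intro dvd_add dvd_smult dvd_mult2)
  moreover have "smult t ((g - r) * (g + r)) + (s - s') = smult t (g * g) + s - (smult t (r * r) + s')"
    by (simp add: algebra_simps smult_diff_right)
  moreover have "degree r \<le> degree f - 1"
    using degree_mod_less'[of f g] assms(2) by (cases "r = 0"; cases "f = 0") (auto simp: r_def)
  then have "degree (smult t (r * r) + s') \<le> 2 * (degree f - 1)"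
    using s'(2) degree_mult_le[of r r] degree_smult_le[of t "r * r"] by (intro degree_add_le) auto
  moreover have "\<forall>x. 0 \<le> poly (smult t (r * r) + s') x"
    using s'(3) add_square.hyps(1) by simp
  ultimately show ?case by metis
qed

definition sign_change_without_root :: "'a::linordered_field poly \<Rightarrow> bool" where
  "sign_change_without_root f \<longleftrightarrow> (\<exists>a b. a < b \<and> poly f a * poly f b < 0 \<and> (\<forall>x. a < x \<longrightarrow> x < b \<longrightarrow> poly f x \<noteq> 0))"

text \<open>
  A counterexample \<open>f\<close> of minimal degree is irreducible, since one factor of a product changes
  sign whenever the product does.  Let \<open>\<beta>\<close> be a root of \<open>f\<close> in the algebraic closure.  If \<open>- 1\<close> were
  the value at \<open>\<beta>\<close> of a sum of weighted squares, then \<open>1 + s' = f * h\<close> for some nonnegative \<open>s'\<close> of degree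
  at most \<open>2 * (degree f - 1)\<close>.  So \<open>h\<close> has smaller degree than \<open>f\<close> and changes sign together with \<open>f\<close>; by minimality
  it has a root, at which the positive polynomial \<open>1 + s'\<close> would vanish.  Hence the ordering extends to the field generated by \<open>\<beta>\<close>,
  and maximality of the cone puts \<open>\<beta>\<close> into the real closure itself, contradicting irreducibility.
\<close>

theorem real_closure_IVT:
  fixes f :: "'a::linordered_field real_closure poly"
  shows "\<not> sign_change_without_root f"
proof
  let ?bad = "sign_change_without_root :: 'a real_closure poly \<Rightarrow> bool"
  assume "?bad f"
  then obtain f :: "'a real_closure poly" where bad: "?bad f"
    and min: "\<And>g. ?bad g \<Longrightarrow> degree f \<le> degree g"
    using ex_has_least_nat[of ?bad f degree] by blast
  from bad obtain a b where ab: "a < b" "poly f a * poly f b < 0"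
    and no_root: "\<And>x. a < x \<Longrightarrow> x < b \<Longrightarrow> poly f x \<noteq> 0" by (auto simp: sign_change_without_root_def)
  have small_root: "\<exists>x. a < x \<and> x < b \<and> poly g x = 0" if "degree g < degree f" "poly g a * poly g b < 0" for g
    using min[of g] that ab(1) by (auto simp: sign_change_without_root_def)
  have irred: "degree g = 0 \<or> degree h = 0" if gh: "f = g * h" for g h
  proof (rule ccontr)
    assume "\<not> ?thesis"
    moreover have "g \<noteq> 0" "h \<noteq> 0" using ab gh by auto
    ultimately have "degree g < degree f" "degree h < degree f" using gh by (auto simp: degree_mult_eq)
    moreover have "(poly g a * poly g b) * (poly h a * poly h b) < 0" using ab(2) gh by (simp add: ac_simps)
    then have "poly g a * poly g b < 0 \<or> poly h a * poly h b < 0" by (auto simp: mult_less_0_iff)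
    ultimately obtain x where "a < x" "x < b" "poly g x = 0 \<or> poly h x = 0" using small_root by blast
    then show False using no_root gh by auto
  qed
  have deg: "2 \<le> degree f"
  proof (rule ccontr)
    assume "\<not> ?thesis"
    then consider "degree f = 0" | "degree f = 1" by linarith
    then show False
    proof cases
      case 1
      then obtain c where "f = [:c:]" by (auto elim: degree_eq_zeroE)
      with ab(2) show False by (simp add: mult_less_0_iff)
    next
      case 2
      then obtain c d where f: "f = [:c, d:]" "d \<noteq> 0"
        by (metis One_nat_def degree_eq_zeroE degree_pCons_eq_if n_not_Suc_n nat.inject pCons_cases pCons_eq_0_iff)
      define x where "x = - c / d"
      have ev: "poly f y = d * (y - x)" for y using f by (simp add: x_def field_simps)
      have "(d * d) * ((a - x) * (b - x)) < 0" using ab(2) by (simp add: ev ac_simps)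
      then have "(a - x) * (b - x) < 0" using f(2) by (auto simp: mult_less_0_iff)
      then have "a < x" "x < b" using ab(1) by (auto simp: mult_less_0_iff)
      with no_root ev[of x] show False by auto
    qed
  qed
  note rep = ring_morphism_Rep_real_closure[where 'a = 'a]
  have rep_inj: "Rep_real_closure x = 0 \<longleftrightarrow> x = 0" for x :: "'a real_closure"
    by (metis Rep_real_closure_inject zero_real_closure.rep_eq)
  have "degree (map_poly Rep_real_closure f) = degree f"
    by (rule degree_map_poly) (simp add: rep_inj)
  then obtain \<beta> where \<beta>: "poly (map_poly Rep_real_closure f) \<beta> = 0"
    using alg_closed_imp_poly_has_root[of "map_poly Rep_real_closure f"] deg by auto
  define ev where "ev g = poly (map_poly Rep_real_closure g) \<beta>" for g :: "'a real_closure poly"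
  have ev: "ring_morphism ev"
    using map_poly_ring_morphism[OF rep] by (simp add: ring_morphism_def ev_def)
  have ev_const: "ev [:c:] = Rep_real_closure c" for c
    by (simp add: ev_def map_poly_pCons zero_real_closure.rep_eq)
  have ev_diff: "ev (g - h) = ev g - ev h" for g h
    using ring_morphism_add[OF ev, of g "- h"] ring_morphism_uminus[OF ev, of h] by simp
  have ev_f: "ev f = 0" using \<beta> by (simp add: ev_def)
  have unit: "\<exists>u. ev u * ev g = 1" if "\<not> f dvd g" for g
  proof -
    have "f \<noteq> 0" using deg by auto
    from poly_bezout[OF this] obtain m u v where m: "m = u * g + v * f" "m \<noteq> 0" "m dvd f" "m dvd g" by blast
    from m(3) obtain k where k: "f = m * k" by (auto elim: dvdE)
    have "degree k \<noteq> 0"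
    proof
      assume "degree k = 0"
      then obtain c where c: "k = [:c:]" by (auto elim: degree_eq_zeroE)
      have "c \<noteq> 0" using c k \<open>f \<noteq> 0\<close> by auto
      then have "m = f * [:inverse c:]" using k c by simp
      then have "f dvd m" by (rule dvdI)
      with m(4) that show False by (blast intro: dvd_trans)
    qed
    with irred[OF k] obtain c where c: "m = [:c:]" by (auto elim: degree_eq_zeroE)
    then have "c \<noteq> 0" using m(2) by auto
    have "ev ([:inverse c:] * u) * ev g = ev ([:inverse c:] * (u * g + v * f))"
      by (simp only: ring_morphism_mult[OF ev] ring_morphism_add[OF ev] ev_f) (simp add: algebra_simps)
    also have "\<dots> = ev 1" using \<open>c \<noteq> 0\<close> c m(1) by (simp add: one_pCons)
    finally show ?thesis using ring_morphism_1[OF ev] by auto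
  qed
  have kernel: "f dvd g" if "ev g = 0" for g
    using unit[of g] that by auto
  define T where "T = ev ` weighted_squares"
  have "field_cone T"
    unfolding field_cone_def
  proof (intro conjI ballI)
    show "0 \<in> T" unfolding T_def using weighted_squares.zero ring_morphism_0[OF ev] by force
    have "1 = smult 1 (1 * 1 :: 'a real_closure poly)" by simp
    then have "(1 :: 'a real_closure poly) \<in> weighted_squares"
      using weighted_squares_square[of "1 :: 'a real_closure" 1] by (simp add: one_pCons)
    then show "1 \<in> T" unfolding T_def using ring_morphism_1[OF ev] by force
    have sq: "ev g * ev g \<in> T" for g
    proof -
      have "smult 1 (g * g) \<in> weighted_squares" by (rule weighted_squares_square) simp
      then show ?thesis unfolding T_def by (force simp: ring_morphism_mult[OF ev])
    qed
    have mult: "x * y \<in> T" if "x \<in> T" "y \<in> T" for x y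
      using that weighted_squares_mult unfolding T_def by (force simp flip: ring_morphism_mult[OF ev])
    fix x assume x: "x \<in> T"
    then obtain s where s: "s \<in> weighted_squares" "x = ev s" by (auto simp: T_def)
    show "inverse x \<in> T"
    proof (cases "x = 0")
      case True
      with x show ?thesis by simp
    next
      case False
      have "\<not> f dvd s"
      proof
        assume "f dvd s"
        then show False using False s(2) ev_f by (auto elim!: dvdE simp: ring_morphism_mult[OF ev])
      qed
      from unit[OF this] obtain u where "ev u * x = 1" using s by auto
      then have "inverse x = x * (ev u * ev u)" using False by (simp add: field_simps) (metis mult.commute mult.left_commute mult_1_right)
      with mult[OF x sq] show ?thesis by simp
    qed
    fix y assume y: "y \<in> T"
    then obtain s' where s': "s' \<in> weighted_squares" "y = ev s'" by (auto simp: T_def)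
    show "x * y \<in> T" using mult x y .
    show "x + y \<in> T" unfolding T_def s s'
      using weighted_squares_add[OF s(1) s'(1)] by (force simp: ring_morphism_add[OF ev])
    show "(x - y) * (x - y) \<in> T" using sq[of "s - s'"] s s' by (simp add: ev_diff)
  next
    show "- 1 \<notin> T"
    proof
      assume "- 1 \<in> T"
      then obtain s where s: "s \<in> weighted_squares" "ev s = - 1" by (auto simp: T_def)
      obtain s' where s': "f dvd s - s'" "degree s' \<le> 2 * (degree f - 1)" "\<And>x. 0 \<le> poly s' x"
        using weighted_squares_mod[OF s(1), of f] deg by auto
      have "ev (s - s') = 0" using s'(1) ev_f by (auto elim!: dvdE simp: ring_morphism_mult[OF ev])
      then have "ev s' = - 1" using s(2) by (simp add: ev_diff)
      then have "ev (1 + s') = 0" by (simp add: ring_morphism_add[OF ev] ring_morphism_1[OF ev])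
      from kernel[OF this] obtain h where h: "1 + s' = f * h" by (auto elim: dvdE)
      have pos: "0 < poly (1 + s') x" for x using s'(3)[of x] by (simp add: add_pos_nonneg)
      then have "h \<noteq> 0" "f \<noteq> 0" using h by (metis mult_zero_left mult_zero_right poly_0 less_irrefl)+
      then have "degree f + degree h = degree (1 + s')" by (simp add: h degree_mult_eq)
      also have "\<dots> \<le> 2 * (degree f - 1)" using s'(2) by (intro degree_add_le) auto
      finally have "degree h < degree f" using deg by linarith
      moreover have "0 < (poly f a * poly f b) * (poly h a * poly h b)"
        using mult_pos_pos[OF pos[of a] pos[of b]] unfolding h by (simp add: ac_simps)
      then have "poly h a * poly h b < 0"
        using ab(2) by (simp add: zero_less_mult_iff[of "poly f a * poly f b"])
      ultimately obtain c where "poly h c = 0" using small_root by blast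
      with pos[of c] show False unfolding h by simp
    qed
  qed
  moreover have "closure_cone \<subseteq> T"
  proof
    fix t :: "'a alg_closure" assume t: "t \<in> closure_cone"
    then obtain t' where t': "t = Rep_real_closure t'"
      using cone_field_of_cone[OF closure_cone(1)] by (metis Rep_real_closure_cases)
    then have "0 \<le> t'" using t by (simp add: less_eq_real_closure.rep_eq zero_real_closure.rep_eq)
    then have "smult t' (1 * 1) \<in> weighted_squares" by (rule weighted_squares_square)
    then have "ev (smult t' (1 * 1)) \<in> T" by (simp add: T_def)
    moreover have "smult t' (1 * 1) = [:t':]" by (simp add: one_pCons)
    ultimately show "t \<in> T" using ev_const t' by simp
  qed
  ultimately have T: "T = closure_cone" by (rule closure_cone(3))
  have "\<beta> \<in> cone_field T"
  proof -
    let ?h = "inverse 2 :: 'a real_closure"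
    \<comment> \<open>The difference of these two squares is the variable, whose value is the root.\<close>
    define g1 g2 where "g1 = smult 1 ([:?h, ?h:] * [:?h, ?h:])" and "g2 = smult 1 ([:- ?h, ?h:] * [:- ?h, ?h:])"
    have "g1 \<in> weighted_squares" "g2 \<in> weighted_squares"
      unfolding g1_def g2_def by (rule weighted_squares_square; simp)+
    then have "ev g1 - ev g2 \<in> cone_field T" by (auto simp: T_def cone_field_def)
    moreover have "g1 - g2 = [:0, 1:]" by (simp add: g1_def g2_def field_simps)
    then have "ev g1 - ev g2 = ev [:0, 1:]" by (simp flip: ev_diff)
    moreover have "ev [:0, 1:] = \<beta>"
      by (simp add: ev_def map_poly_pCons zero_real_closure.rep_eq one_real_closure.rep_eq)
    ultimately show ?thesis by simp
  qed
  then obtain r where r: "\<beta> = Rep_real_closure r" unfolding T by (rule Rep_real_closure_cases)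
  have "ev [:- r, 1:] = 0"
    by (simp add: ev_def map_poly_pCons zero_real_closure.rep_eq one_real_closure.rep_eq r ring_morphism_uminus[OF rep])
  from kernel[OF this] have "degree f \<le> degree [:- r, 1:]" by (rule dvd_imp_degree_le) simp
  with deg show False by simp
qed

instance real_closure :: (linordered_field) real_closed_field
proof
  fix a b :: "'a real_closure" and c n
  assume ab: "a < b" and neg: "(\<Sum>i\<le>n. c i * a ^ i) < 0" and pos: "0 < (\<Sum>i\<le>n. c i * b ^ i)"
  define f where "f = (\<Sum>i\<le>n. monom (c i) i)"
  have "poly f x = (\<Sum>i\<le>n. c i * x ^ i)" for x
    by (simp add: f_def poly_sum poly_monom)
  with real_closure_IVT[of f] ab mult_neg_pos[OF neg pos]
  show "\<exists>x>a. x < b \<and> (\<Sum>i\<le>n. c i * x ^ i) = 0"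
    by (auto simp: sign_change_without_root_def)
qed

definition to_rc :: "'a::linordered_field \<Rightarrow> 'a real_closure" where
  "to_rc x = Abs_real_closure (to_ac x)"

lemma ring_morphism_to_rc: "ring_morphism (to_rc :: 'a::linordered_field \<Rightarrow> _)"
proof -
  have "to_ac x \<in> cone_field (closure_cone :: 'a alg_closure set)" for x :: 'a
  proof (cases "0 \<le> x")
    case True
    then have "to_ac x \<in> closure_cone" using closure_cone(2) by auto
    then show ?thesis by (rule cone_field_of_cone[OF closure_cone(1)])
  next
    case False
    then have "to_ac (- x) \<in> closure_cone" using closure_cone(2) by (auto simp del: to_ac_minus)
    then have "- to_ac (- x) \<in> cone_field closure_cone"
      using cone_field_of_cone[OF closure_cone(1)] cone_field_closed(4)[OF closure_cone(1)] by blast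
    then show ?thesis by simp
  qed
  then have rep: "Rep_real_closure (to_rc x) = to_ac x" for x :: 'a
    by (simp add: to_rc_def Abs_real_closure_inverse)
  show ?thesis
    unfolding ring_morphism_def
    by (simp add: rep one_real_closure.rep_eq plus_real_closure.rep_eq times_real_closure.rep_eq flip: Rep_real_closure_inject)
qed

section \<open>Orderings of the polynomial ring have real points\<close>

lemma poly_eval_eq_mpoly_eval: "poly_eval f x = mpoly_eval id (($) x) f"
  by (simp add: poly_eval_def mpoly_eval_def)

lemma ring_morphism_id: "ring_morphism id"
  by (simp add: ring_morphism_def)

definition ring_cone :: "'a::comm_ring_1 set \<Rightarrow> bool" where
  "ring_cone T \<longleftrightarrow> (\<forall>x\<in>T. \<forall>y\<in>T. x + y \<in> T \<and> x * y \<in> T) \<and> (\<forall>x. x * x \<in> T) \<and> - 1 \<notin> T"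

lemma ring_coneD:
  assumes "ring_cone T"
  shows "x \<in> T \<Longrightarrow> y \<in> T \<Longrightarrow> x + y \<in> T" "x \<in> T \<Longrightarrow> y \<in> T \<Longrightarrow> x * y \<in> T" "x * x \<in> T"
    "- 1 \<notin> T" "0 \<in> T" "1 \<in> T"
  using assms unfolding ring_cone_def by (auto dest: spec[of _ 0] spec[of _ 1])

definition ring_ordering :: "'a::comm_ring_1 set \<Rightarrow> bool" where
  "ring_ordering P \<longleftrightarrow> ring_cone P \<and> (\<forall>x. x \<in> P \<or> - x \<in> P) \<and>
     (\<forall>x y. x * y \<in> P \<and> - (x * y) \<in> P \<longrightarrow> x \<in> P \<and> - x \<in> P \<or> y \<in> P \<and> - y \<in> P)"

lemma ring_cone_maximal:
  assumes "ring_cone T0"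
  shows "\<exists>T. ring_cone T \<and> T0 \<subseteq> T \<and> (\<forall>S. ring_cone S \<longrightarrow> T \<subseteq> S \<longrightarrow> S = T)"
proof -
  have "\<exists>T\<in>{T. ring_cone T \<and> T0 \<subseteq> T}. \<forall>S\<in>{T. ring_cone T \<and> T0 \<subseteq> T}. T \<subseteq> S \<longrightarrow> S = T"
  proof (rule subset_Zorn_nonempty)
    show "{T. ring_cone T \<and> T0 \<subseteq> T} \<noteq> {}" using assms by blast
    fix Ch assume Ch: "Ch \<noteq> {}" "subset.chain {T. ring_cone T \<and> T0 \<subseteq> T} Ch"
    have cone: "ring_cone T" "T0 \<subseteq> T" if "T \<in> Ch" for T
      using Ch(2) that unfolding subset_chain_def by blast+
    have comparable: "A \<subseteq> B \<or> B \<subseteq> A" if "A \<in> Ch" "B \<in> Ch" for A B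
      using Ch(2) that unfolding subset_chain_def by blast
    have both: "\<exists>T\<in>Ch. x \<in> T \<and> y \<in> T" if xy: "x \<in> \<Union>Ch" "y \<in> \<Union>Ch" for x y
    proof -
      obtain A where A: "A \<in> Ch" "x \<in> A" using xy(1) by blast
      obtain B where B: "B \<in> Ch" "y \<in> B" using xy(2) by blast
      show ?thesis using comparable[OF A(1) B(1)] A B by blast
    qed
    have "ring_cone (\<Union>Ch)"
      unfolding ring_cone_def
    proof (intro conjI ballI allI)
      show "- 1 \<notin> \<Union>Ch" using cone(1)[THEN ring_coneD(4)] by blast
      show "x * x \<in> \<Union>Ch" for x using Ch(1) cone(1)[THEN ring_coneD(3)] by blast
      fix x y assume "x \<in> \<Union>Ch" "y \<in> \<Union>Ch"
      then obtain T where T: "T \<in> Ch" "x \<in> T" "y \<in> T" using both by blast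
      show "x + y \<in> \<Union>Ch" "x * y \<in> \<Union>Ch"
        using ring_coneD(1,2)[OF cone(1)[OF T(1)] T(2,3)] T(1) by blast+
    qed
    moreover have "T0 \<subseteq> \<Union>Ch" using Ch(1) cone(2) by blast
    ultimately show "\<Union>Ch \<in> {T. ring_cone T \<and> T0 \<subseteq> T}" by blast
  qed
  then obtain T where T: "ring_cone T" "T0 \<subseteq> T"
    and max: "\<And>S. ring_cone S \<and> T0 \<subseteq> S \<Longrightarrow> T \<subseteq> S \<Longrightarrow> S = T" by auto
  have "\<forall>S. ring_cone S \<longrightarrow> T \<subseteq> S \<longrightarrow> S = T"
    using max order_trans[OF T(2)] by blast
  with T show ?thesis by blast
qed

text \<open>
  Take a maximal cone \<open>P\<close>.  For \<open>c\<close> outside \<open>P\<close> maximality gives \<open>- 1 = s + c * t\<close> with \<open>s\<close> and \<open>t\<close> in \<open>P\<close>.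
  Multiplying two such identities, for \<open>x\<close> and \<open>- x\<close> or for two elements outside the support, exhibits \<open>- 1\<close> in \<open>P\<close>
  unless \<open>P\<close> is total and its support is prime.
\<close>

lemma ring_cone_extends_to_ordering:
  fixes T0 :: "'a::comm_ring_1 set"
  assumes "ring_cone T0"
  shows "\<exists>P. ring_ordering P \<and> T0 \<subseteq> P"
proof -
  obtain P where P: "ring_cone P" "T0 \<subseteq> P" and max: "\<And>S. ring_cone S \<Longrightarrow> P \<subseteq> S \<Longrightarrow> S = P"
    using ring_cone_maximal[OF assms] by blast
  note D = ring_coneD[OF P(1)]
  have adjoin: "\<exists>s\<in>P. \<exists>t\<in>P. - 1 = s + c * t" if "c \<notin> P" for c
  proof (rule ccontr)
    assume neg: "\<not> ?thesis"
    define S where "S = {s + c * t | s t. s \<in> P \<and> t \<in> P}"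
    have SI: "s + c * t \<in> S" if "s \<in> P" "t \<in> P" for s t using that by (auto simp: S_def)
    have PS: "P \<subseteq> S" using SI[OF _ D(5)] by auto
    have "ring_cone S"
      unfolding ring_cone_def
    proof (intro conjI ballI allI)
      show "- 1 \<notin> S" using neg by (auto simp: S_def)
      show "x * x \<in> S" for x using PS D(3) by blast
      fix x y assume "x \<in> S" "y \<in> S"
      then obtain s t s' t' where *: "x = s + c * t" "y = s' + c * t'" "s \<in> P" "t \<in> P" "s' \<in> P" "t' \<in> P"
        by (auto simp: S_def)
      have "(s + s') + c * (t + t') \<in> S" by (intro SI D(1) *(3-6))
      then show "x + y \<in> S" by (simp add: *(1,2) algebra_simps)
      have "(s * s' + (c * c) * (t * t')) + c * (s * t' + s' * t) \<in> S" by (intro SI D(1-3) *(3-6))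
      then show "x * y \<in> S" by (simp add: *(1,2) algebra_simps)
    qed
    from max[OF this PS] have "S = P" .
    moreover have "0 + c * 1 \<in> S" using SI[OF D(5,6)] .
    ultimately show False using that by simp
  qed
  have solve: "z = - (1 + s)" if "- 1 = s + z" for s z :: 'a
  proof -
    have "z = (s + z) - s" by simp
    also have "\<dots> = - (1 + s)" unfolding that[symmetric] by simp
    finally show ?thesis .
  qed
  have total: "x \<in> P \<or> - x \<in> P" for x
  proof (rule ccontr)
    assume "\<not> ?thesis"
    then obtain s t s' t' where *: "- 1 = s + x * t" "- 1 = s' + (- x) * t'" "s \<in> P" "t \<in> P" "s' \<in> P" "t' \<in> P"
      using adjoin[of x] adjoin[of "- x"] by blast
    have xt: "x * t = - (1 + s)" by (rule solve[OF *(1)])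
    have xt': "x * t' = 1 + s'"
      using solve[OF *(2)] unfolding mult_minus_left neg_equal_iff_equal .
    have "(x * x) * (t * t') = (x * t) * (x * t')" by (simp add: ac_simps)
    also have "\<dots> = - 1 - (s + s' + s * s')" unfolding xt xt' by (simp add: algebra_simps)
    finally have "- 1 = (s + s' + s * s') + (x * x) * (t * t')" by simp
    also have "\<dots> \<in> P" using * D(1,2,3) by simp
    finally show False using D(4) by simp
  qed
  have prime: "x \<in> P \<and> - x \<in> P \<or> y \<in> P \<and> - y \<in> P" if xy: "x * y \<in> P" "- (x * y) \<in> P" for x y
  proof (rule ccontr)
    assume neg: "\<not> ?thesis"
    obtain c where c: "c \<notin> P" "c = x \<or> c = - x" using neg by blast
    obtain d where d: "d \<notin> P" "d = y \<or> d = - y" using neg by blast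
    have cd: "- (c * d) \<in> P" using c d xy by auto
    obtain s t s' t' where *: "- 1 = s + c * t" "- 1 = s' + d * t'" "s \<in> P" "t \<in> P" "s' \<in> P" "t' \<in> P"
      using adjoin[OF c(1)] adjoin[OF d(1)] by blast
    have ct: "c * t = - (1 + s)" "d * t' = - (1 + s')" by (rule solve[OF *(1)], rule solve[OF *(2)])
    have "(c * d) * (t * t') = (c * t) * (d * t')" by (simp add: ac_simps)
    also have "\<dots> = 1 + (s + s' + s * s')" unfolding ct by (simp add: algebra_simps)
    finally have "- 1 = (s + s' + s * s') + (- (c * d)) * (t * t')" by simp
    also have "\<dots> \<in> P" by (intro D(1,2) *(3-6) cd)
    finally show False using D(4) by simp
  qed
  have "ring_ordering P" unfolding ring_ordering_def using P(1) total prime by blast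
  with P(2) show ?thesis by blast
qed

lemma ring_orderingD:
  assumes "ring_ordering P"
  shows "x \<in> P \<Longrightarrow> y \<in> P \<Longrightarrow> x + y \<in> P" "x \<in> P \<Longrightarrow> y \<in> P \<Longrightarrow> x * y \<in> P" "x * x \<in> P"
    "- 1 \<notin> P" "0 \<in> P" "1 \<in> P" "x \<in> P \<or> - x \<in> P"
    "x * y \<in> P \<Longrightarrow> - (x * y) \<in> P \<Longrightarrow> x \<in> P \<and> - x \<in> P \<or> y \<in> P \<and> - y \<in> P"
proof -
  have P: "ring_cone P" using assms by (simp add: ring_ordering_def)
  note D = ring_coneD[OF P]
  show "x \<in> P \<Longrightarrow> y \<in> P \<Longrightarrow> x + y \<in> P" "x \<in> P \<Longrightarrow> y \<in> P \<Longrightarrow> x * y \<in> P" "x * x \<in> P"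
    "- 1 \<notin> P" "0 \<in> P" "1 \<in> P"
    using D by auto
  show "x \<in> P \<or> - x \<in> P"
    "x * y \<in> P \<Longrightarrow> - (x * y) \<in> P \<Longrightarrow> x \<in> P \<and> - x \<in> P \<or> y \<in> P \<and> - y \<in> P"
    using assms unfolding ring_ordering_def by blast+
qed

lemma support_mult:
  assumes P: "ring_ordering P" and x: "x \<in> P" "- x \<in> P"
  shows "c * x \<in> P" "- (c * x) \<in> P"
proof -
  have *: "d * x \<in> P \<and> - (d * x) \<in> P" if "d \<in> P" for d
    using ring_orderingD(2)[OF P that x(1)] ring_orderingD(2)[OF P that x(2)] by simp
  from ring_orderingD(7)[OF P, of c] *[of c] *[of "- c"] show "c * x \<in> P" "- (c * x) \<in> P" by auto
qed

definition support :: "'a::comm_ring_1 set \<Rightarrow> 'a set" where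
  "support P = {x. x \<in> P \<and> - x \<in> P}"

definition real_points_for :: "'n::finite rpoly set \<Rightarrow> bool" where
  "real_points_for P \<longleftrightarrow> (\<forall>C\<subseteq>support P. finite C \<longrightarrow> (\<exists>a. \<forall>f\<in>C. poly_eval f a = 0))"

text \<open>
  A type can depend on type variables but not on the hypotheses of a theorem.  Therefore one
  ordering is fixed for which finding real points is hardest: if the theorem on real
  points fails for some ordering, it fails for this one.  The residue ring of this ordering can
  then be made a type.
\<close>

definition critical_ordering :: "'n::finite rpoly set" where
  "critical_ordering = (SOME P. ring_ordering P \<and> ((\<exists>Q::'n rpoly set. ring_ordering Q \<and> \<not> real_points_for Q) \<longrightarrow> \<not> real_points_for P))"

lemma critical_ordering:
  "ring_ordering (critical_ordering :: 'n::finite rpoly set)"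
  "ring_ordering (Q :: 'n rpoly set) \<Longrightarrow> real_points_for (critical_ordering :: 'n rpoly set) \<Longrightarrow> real_points_for Q"
proof -
  have "\<exists>P::'n rpoly set. ring_ordering P \<and> ((\<exists>Q::'n rpoly set. ring_ordering Q \<and> \<not> real_points_for Q) \<longrightarrow> \<not> real_points_for P)"
  proof (cases "\<exists>Q::'n rpoly set. ring_ordering Q \<and> \<not> real_points_for Q")
    case True
    then show ?thesis by blast
  next
    case False
    note H = ring_morphism_mpoly_eval[OF ring_morphism_id, of "\<lambda>_::'n. 1"]
    have "ring_cone {f :: 'n rpoly. 0 \<le> mpoly_eval id (\<lambda>_. 1) f}"
      by (simp add: ring_cone_def ring_morphism_add[OF H] ring_morphism_mult[OF H] ring_morphism_uminus[OF H] ring_morphism_1[OF H])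
    from ring_cone_extends_to_ordering[OF this] False show ?thesis by blast
  qed
  from someI_ex[OF this] have *: "ring_ordering (critical_ordering :: 'n rpoly set) \<and>
      ((\<exists>Q::'n rpoly set. ring_ordering Q \<and> \<not> real_points_for Q) \<longrightarrow> \<not> real_points_for (critical_ordering :: 'n rpoly set))"
    unfolding critical_ordering_def .
  then show "ring_ordering (critical_ordering :: 'n::finite rpoly set)" by blast
  show "ring_ordering (Q :: 'n rpoly set) \<Longrightarrow> real_points_for (critical_ordering :: 'n rpoly set) \<Longrightarrow> real_points_for Q"
    using * by blast
qed

definition critical_cong :: "'n::finite rpoly \<Rightarrow> 'n rpoly \<Rightarrow> bool" where
  "critical_cong f g \<longleftrightarrow> f - g \<in> critical_ordering \<and> g - f \<in> critical_ordering"

lemmas critical_D = ring_orderingD[OF critical_ordering(1)]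

lemma critical_cong_iff: "critical_cong f g \<longleftrightarrow> f - g \<in> critical_ordering \<and> - (f - g) \<in> critical_ordering"
  by (simp add: critical_cong_def)

quotient_type 'n critical_quotient = "'n::finite rpoly" / critical_cong
  morphisms critical_representative critical_class
proof (rule equivpI)
  show "reflp (critical_cong :: 'n rpoly \<Rightarrow> _)" by (auto intro: reflpI simp: critical_cong_def critical_D(5))
  show "symp (critical_cong :: 'n rpoly \<Rightarrow> _)" by (auto intro: sympI simp: critical_cong_def)
  show "transp (critical_cong :: 'n rpoly \<Rightarrow> _)"
  proof (rule transpI)
    fix f g k :: "'n rpoly"
    assume "critical_cong f g" "critical_cong g k"
    then show "critical_cong f k"
      using critical_D(1)[of "f - g" "g - k"] critical_D(1)[of "k - g" "g - f"] by (simp add: critical_cong_def)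
  qed
qed

lemma critical_cong_add: "critical_cong f f' \<Longrightarrow> critical_cong g g' \<Longrightarrow> critical_cong (f + g) (f' + g')"
  using critical_D(1)[of "f - f'" "g - g'"] critical_D(1)[of "f' - f" "g' - g"]
  by (simp add: critical_cong_def algebra_simps)

lemma critical_cong_uminus: "critical_cong f f' \<Longrightarrow> critical_cong (- f) (- f')"
  by (simp add: critical_cong_def)

lemma critical_cong_diff: "critical_cong f f' \<Longrightarrow> critical_cong g g' \<Longrightarrow> critical_cong (f - g) (f' - g')"
  using critical_cong_add[of f f' "- g" "- g'"] critical_cong_uminus[of g g'] by simp

lemma critical_cong_mult: "critical_cong f f' \<Longrightarrow> critical_cong g g' \<Longrightarrow> critical_cong (f * g) (f' * g')"
proof -
  assume *: "critical_cong f f'" "critical_cong g g'"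
  have "critical_cong (f * g) (f * g')"
    using support_mult[OF critical_ordering(1), of "g - g'" f] *(2)
    by (simp add: critical_cong_iff right_diff_distrib)
  moreover have "critical_cong (f * g') (f' * g')"
  proof -
    have "g' * (f - f') = f * g' - f' * g'" by (simp add: algebra_simps)
    with support_mult[OF critical_ordering(1), of "f - f'" g'] *(1) show ?thesis
      by (simp only: critical_cong_iff)
  qed
  ultimately show ?thesis
    using critical_quotient_equivp by (meson equivp_transp)
qed

instantiation critical_quotient :: (finite) comm_ring_1
begin

lift_definition zero_critical_quotient :: "'a critical_quotient" is 0 .
lift_definition one_critical_quotient :: "'a critical_quotient" is 1 .
lift_definition plus_critical_quotient :: "'a critical_quotient \<Rightarrow> 'a critical_quotient \<Rightarrow> 'a critical_quotient"
  is "(+)" by (rule critical_cong_add)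
lift_definition uminus_critical_quotient :: "'a critical_quotient \<Rightarrow> 'a critical_quotient"
  is uminus by (rule critical_cong_uminus)
lift_definition minus_critical_quotient :: "'a critical_quotient \<Rightarrow> 'a critical_quotient \<Rightarrow> 'a critical_quotient"
  is "(-)" by (rule critical_cong_diff)
lift_definition times_critical_quotient :: "'a critical_quotient \<Rightarrow> 'a critical_quotient \<Rightarrow> 'a critical_quotient"
  is "(*)" by (rule critical_cong_mult)

instance
proof
  show "(0 :: 'a critical_quotient) \<noteq> 1"
    by transfer (simp add: critical_cong_def critical_D(4))
qed (transfer, simp add: critical_cong_def critical_D(5) algebra_simps)+

end

instantiation critical_quotient :: (finite) linordered_idom
begin

lift_definition less_eq_critical_quotient :: "'a critical_quotient \<Rightarrow> 'a critical_quotient \<Rightarrow> bool"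
  is "\<lambda>f g. g - f \<in> critical_ordering"
proof -
  have *: "g' - f' \<in> critical_ordering" if "critical_cong f f'" "critical_cong g g'" "g - f \<in> critical_ordering"
    for f g f' g' :: "'a rpoly"
    using critical_D(1)[OF critical_D(1)[of "g' - g" "f - f'"] that(3)] that(1,2) by (simp add: critical_cong_def)
  show "(g - f \<in> critical_ordering) = (g' - f' \<in> critical_ordering)" if "critical_cong f f'" "critical_cong g g'"
    for f g f' g' :: "'a rpoly"
    using *[OF that] *[of f' f g' g] that by (auto simp: critical_cong_def)
qed

definition less_critical_quotient :: "'a critical_quotient \<Rightarrow> 'a critical_quotient \<Rightarrow> bool" where
  "less_critical_quotient x y \<longleftrightarrow> x \<le> y \<and> \<not> y \<le> x"
definition abs_critical_quotient :: "'a critical_quotient \<Rightarrow> 'a critical_quotient" where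
  "abs_critical_quotient x = (if x < 0 then - x else x)"
definition sgn_critical_quotient :: "'a critical_quotient \<Rightarrow> 'a critical_quotient" where
  "sgn_critical_quotient x = (if x = 0 then 0 else if 0 < x then 1 else - 1)"

instance
proof
  fix x y z :: "'a critical_quotient"
  show "x \<le> x" by transfer (simp add: critical_D(5))
  show "x \<le> z" if "x \<le> y" "y \<le> z"
    using that
  proof transfer
    fix f g k :: "'a rpoly"
    assume "g - f \<in> critical_ordering" "k - g \<in> critical_ordering"
    from critical_D(1)[OF this] show "k - f \<in> critical_ordering" by simp
  qed
  show antisym: "x = y" if "x \<le> y" "y \<le> x" for x y :: "'a critical_quotient"
    using that by transfer (simp add: critical_cong_def)
  show "(x < y) = (x \<le> y \<and> \<not> y \<le> x)" by (rule less_critical_quotient_def)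
  show "x \<le> y \<or> y \<le> x" by transfer (metis critical_D(7) minus_diff_eq)
  show "z + x \<le> z + y" if "x \<le> y" using that by transfer simp
  have mult: "0 \<le> x * y" if "0 \<le> x" "0 \<le> y" for x y :: "'a critical_quotient"
    using that by transfer (simp add: critical_D(2))
  have integral: "x = 0 \<or> y = 0" if "x * y = 0" for x y :: "'a critical_quotient"
    using that by transfer (auto simp: critical_cong_def dest: critical_D(8))
  have diff: "x \<le> y \<longleftrightarrow> 0 \<le> y - x" for x y :: "'a critical_quotient" by transfer simp
  show "z * x < z * y" if "x < y" "0 < z"
  proof -
    have xy: "0 \<le> y - x" "y - x \<noteq> 0" "0 \<le> z" "z \<noteq> 0"
      using that diff[of x y] by (auto simp: less_critical_quotient_def)
    have "z * x \<le> z * y" using mult[OF xy(3,1)] unfolding diff[of "z * x"] by (simp add: right_diff_distrib)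
    moreover have "z * x \<noteq> z * y" using integral[of z "y - x"] xy by (auto simp: right_diff_distrib)
    ultimately show ?thesis unfolding less_critical_quotient_def using antisym by blast
  qed
  show "\<bar>x\<bar> = (if x < 0 then - x else x)" by (rule abs_critical_quotient_def)
  show "sgn x = (if x = 0 then 0 else if 0 < x then 1 else - 1)" by (rule sgn_critical_quotient_def)
qed

end

text \<open>
  For the critical ordering, the composite of the residue map with the embeddings into the fraction field and its
  real closure is a morphism that kills the support.  It is evaluation at a point over a
  real closed field, where all elements of the support vanish; real points with the same
  signs are common zeros.
\<close>

theorem ordering_real_points:
  assumes "ring_ordering (P :: 'n::finite rpoly set)"
  shows "real_points_for P"
proof (rule critical_ordering(2)[OF assms])
  define H where "H f = to_rc (Fract (critical_class f) 1)" for f :: "'n rpoly"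
  note rc = ring_morphism_to_rc[where 'a = "'n critical_quotient fract"]
  have H: "ring_morphism H"
    unfolding ring_morphism_def
  proof (intro conjI allI)
    show "H 1 = 1"
      using ring_morphism_1[OF rc] by (simp add: H_def One_fract_def one_critical_quotient.abs_eq[symmetric])
    show "H (f + g) = H f + H g" for f g
      by (simp add: H_def plus_critical_quotient.abs_eq[symmetric] flip: ring_morphism_add[OF rc])
    show "H (f * g) = H f * H g" for f g
      by (simp add: H_def times_critical_quotient.abs_eq[symmetric] flip: ring_morphism_mult[OF rc])
  qed
  show "real_points_for (critical_ordering :: 'n rpoly set)"
    unfolding real_points_for_def
  proof (intro allI impI)
    fix C :: "'n rpoly set" assume C: "C \<subseteq> support critical_ordering" "finite C"
    have zero: "H f = 0" if "f \<in> C" for f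
    proof -
      have "critical_cong f 0" using that C(1) by (auto simp: critical_cong_def support_def)
      then have "critical_class f = critical_class 0" by (simp add: critical_quotient.abs_eq_iff)
      then have "H f = H 0" by (simp add: H_def)
      then show ?thesis by (simp add: ring_morphism_0[OF H])
    qed
    let ?h = "\<lambda>r. H (Poly_Mapping.single 0 r)" and ?c = "\<lambda>i. H (Poly_Mapping.single (Poly_Mapping.single i 1) 1)"
    have h: "ring_morphism ?h"
      unfolding ring_morphism_def
    proof (intro conjI allI)
      show "?h 1 = 1" by (simp add: ring_morphism_1[OF H])
      show "?h (r + s) = ?h r + ?h s" for r s by (simp add: single_add ring_morphism_add[OF H])
      show "?h (r * s) = ?h r * ?h s" for r s by (simp add: mult_single flip: ring_morphism_mult[OF H])
    qed
    obtain a where a: "\<forall>f\<in>C. same_sign (mpoly_eval ?h ?c f) (mpoly_eval id a f)"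
      using signs_realized_over_reals[OF h C(2), of ?c] by blast
    have "poly_eval f (\<chi> i. a i) = 0" if "f \<in> C" for f
    proof -
      have "mpoly_eval ?h ?c f = 0" using mpoly_eval_unique[OF H, of f] zero[OF that] by simp
      then have "mpoly_eval id a f = 0" using a that by (auto simp: same_sign_def linorder_neq_iff)
      moreover have "($) (\<chi> i. a i) = a" by auto
      ultimately show ?thesis by (simp only: poly_eval_eq_mpoly_eval)
    qed
    then show "\<exists>a. \<forall>f\<in>C. poly_eval f a = 0" by blast
  qed
qed

section \<open>The real Nullstellensatz\<close>

inductive_set sos :: "'a::comm_ring_1 set" where
  zero: "0 \<in> sos"
| add_square: "s \<in> sos \<Longrightarrow> f * f + s \<in> sos"

lemma sos_add: "s \<in> sos \<Longrightarrow> s' \<in> sos \<Longrightarrow> s + s' \<in> sos"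
  by (induction rule: sos.induct) (auto simp: add.assoc intro: sos.add_square)

lemma sos_mult:
  assumes "s \<in> sos" "s' \<in> sos"
  shows "s * s' \<in> sos"
  using assms(1)
proof induction
  case zero
  then show ?case by (simp add: sos.zero)
next
  case (add_square s f)
  have "f * f * s' \<in> sos"
    using assms(2)
  proof induction
    case zero
    then show ?case by (simp add: sos.zero)
  next
    case (add_square s' g)
    have "f * f * (g * g + s') = (f * g) * (f * g) + f * f * s'" by (simp add: algebra_simps)
    then show ?case using sos.add_square[OF add_square.IH, of "f * g"] by simp
  qed
  then show ?case using add_square.IH by (simp add: distrib_right sos_add)
qed

lemma ideal_generator: 
  assumes "j \<in> {1..m}"
  shows "q * h j \<in> gen_ideal m h"
proof -
  have "(\<Sum>i=1..m. (if i = j then q else 0) * h i) = (\<Sum>i=1..m. if i = j then q * h j else 0)"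
    by (intro sum.cong) auto
  then have "q * h j = (\<Sum>i=1..m. (if i = j then q else 0) * h i)" using assms by simp
  then show ?thesis
    unfolding gen_ideal_def by (intro CollectI exI[of _ "\<lambda>i. if i = j then q else 0"]) simp
qed

lemma real_variety_gen_ideal:
  "real_variety (gen_ideal m h) = {x. \<forall>j\<in>{1..m}. poly_eval (h j) x = 0}"
proof (intro equalityI subsetI CollectI ballI)
  fix x j assume "x \<in> real_variety (gen_ideal m h)" "j \<in> {1..m}"
  then show "poly_eval (h j) x = 0"
    using ideal_generator[of j m 1 h] by (auto simp: real_variety_def)
next
  fix x assume x: "x \<in> {x. \<forall>j\<in>{1..m}. poly_eval (h j) x = 0}"
  note H = ring_morphism_mpoly_eval[OF ring_morphism_id, of "($) x"]
  show "x \<in> real_variety (gen_ideal m h)"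
    using x by (auto simp: real_variety_def gen_ideal_def poly_eval_eq_mpoly_eval
        ring_morphism_sum[OF H] ring_morphism_mult[OF H])
qed

text \<open>
  Otherwise the sums of squares modulo the ideal form a cone.  An ordering containing it
  has the generators in its support, and the real point provided by the ordering is a common zero.
\<close>

theorem real_nullstellensatz:
  fixes h :: "nat \<Rightarrow> 'n::finite rpoly"
  assumes "real_variety (gen_ideal m h) = {}"
  shows "\<exists>s\<in>sos. 1 + s \<in> gen_ideal m h"
proof (rule ccontr)
  assume neg: "\<not> ?thesis"
  let ?I = "gen_ideal m h"
  have I_add: "f + g \<in> ?I" if fg: "f \<in> ?I" "g \<in> ?I" for f g
  proof -
    from fg obtain q q' where "f = (\<Sum>j=1..m. q j * h j)" "g = (\<Sum>j=1..m. q' j * h j)" by (auto simp: gen_ideal_def)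
    then have "f + g = (\<Sum>j=1..m. (q j + q' j) * h j)" by (simp add: distrib_right sum.distrib)
    then show ?thesis unfolding gen_ideal_def by (intro CollectI exI[of _ "\<lambda>j. q j + q' j"]) simp
  qed
  have I_mult: "c * f \<in> ?I" if f: "f \<in> ?I" for c f
  proof -
    from f obtain q where "f = (\<Sum>j=1..m. q j * h j)" by (auto simp: gen_ideal_def)
    then have "c * f = (\<Sum>j=1..m. (c * q j) * h j)" by (simp add: sum_distrib_left mult.assoc)
    then show ?thesis unfolding gen_ideal_def by (intro CollectI exI[of _ "\<lambda>j. c * q j"]) simp
  qed
  have I_0: "0 \<in> ?I" unfolding gen_ideal_def by (auto intro!: exI[of _ "\<lambda>_. 0"])
  define T where "T = {s + f | s f. s \<in> sos \<and> f \<in> ?I}"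
  have "ring_cone T"
    unfolding ring_cone_def
  proof (intro conjI ballI allI)
    show "- 1 \<notin> T"
    proof
      assume "- 1 \<in> T"
      then obtain s f where sf: "- 1 = s + f" "s \<in> sos" "f \<in> ?I" by (auto simp: T_def)
      have "f = (s + f) - s" by simp
      also have "\<dots> = - 1 - s" unfolding sf(1)[symmetric] ..
      finally have "1 + s = (- 1) * f" by simp
      with I_mult[OF sf(3)] neg sf(2) show False by metis
    qed
    show "f * f \<in> T" for f
      using sos.add_square[OF sos.zero, of f] I_0 unfolding T_def by force
    fix f g assume "f \<in> T" "g \<in> T"
    then obtain s a s' a' where *: "f = s + a" "g = s' + a'" "s \<in> sos" "s' \<in> sos" "a \<in> ?I" "a' \<in> ?I"
      by (auto simp: T_def)
    have "f + g = (s + s') + (a + a')" by (simp add: * ac_simps)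
    then show "f + g \<in> T" using sos_add I_add * unfolding T_def by blast
    have "f * g = s * s' + (s * a' + g * a)" by (simp add: * algebra_simps)
    then show "f * g \<in> T" using sos_mult I_add I_mult * unfolding T_def by blast
  qed
  from ring_cone_extends_to_ordering[OF this] obtain P where P: "ring_ordering P" "T \<subseteq> P" by blast
  have "h ` {1..m} \<subseteq> support P"
  proof
    fix f assume "f \<in> h ` {1..m}"
    then obtain j where j: "j \<in> {1..m}" "f = h j" by blast
    have "c * h j \<in> P" for c
      using ideal_generator[OF j(1), of c h] sos.zero P(2) unfolding T_def by force
    from this[of 1] this[of "- 1"] show "f \<in> support P" by (simp add: support_def j(2))
  qed
  with ordering_real_points[OF P(1)] obtain a where "\<forall>f\<in>h ` {1..m}. poly_eval f a = 0"
    unfolding real_points_for_def by blast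
  then have "a \<in> real_variety ?I" by (simp add: real_variety_gen_ideal)
  with assms show False by simp
qed

section \<open>Moment sequences\<close>

text \<open>
  The linear functional on polynomials that sends the monomial with exponent \<open>\<alpha>\<close> to \<open>y \<alpha>\<close>.  Moment
  conditions on \<open>y\<close> are conditions on its values at squares and at multiples of the generators.
\<close>

definition riesz :: "('n::finite monom \<Rightarrow> real) \<Rightarrow> 'n rpoly \<Rightarrow> real" where
  "riesz y f = (\<Sum>\<alpha>\<in>Poly_Mapping.keys f. Poly_Mapping.lookup f \<alpha> * y \<alpha>)"

lemma riesz_superset:
  assumes "finite A" "Poly_Mapping.keys f \<subseteq> A"
  shows "riesz y f = (\<Sum>\<alpha>\<in>A. Poly_Mapping.lookup f \<alpha> * y \<alpha>)"
  unfolding riesz_def using assms by (intro sum.mono_neutral_left) (auto simp: in_keys_iff)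

lemma riesz_add: "riesz y (f + g) = riesz y f + riesz y g"
proof -
  let ?A = "Poly_Mapping.keys f \<union> Poly_Mapping.keys g"
  have "Poly_Mapping.keys (f + g) \<subseteq> ?A" by (rule Poly_Mapping.keys_add)
  then show ?thesis
    by (simp add: riesz_superset[of ?A] lookup_add distrib_right sum.distrib)
qed

lemma riesz_0: "riesz y 0 = 0" by (simp add: riesz_def)

lemma riesz_sum: "riesz y (\<Sum>i\<in>A. f i) = (\<Sum>i\<in>A. riesz y (f i))"
  by (induction A rule: infinite_finite_induct) (simp_all add: riesz_add riesz_0)

lemma riesz_single: "riesz y (Poly_Mapping.single \<alpha> c) = c * y \<alpha>"
  by (simp add: riesz_def)

lemma riesz_mult:
  "riesz y (f * g) = (\<Sum>\<alpha>\<in>Poly_Mapping.keys f. Poly_Mapping.lookup f \<alpha> * shift_seq g y \<alpha>)"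
proof -
  let ?s = "\<lambda>f \<alpha>. Poly_Mapping.single \<alpha> (Poly_Mapping.lookup f \<alpha>)"
  have "f * g = (\<Sum>\<alpha>\<in>Poly_Mapping.keys f. ?s f \<alpha>) * (\<Sum>\<beta>\<in>Poly_Mapping.keys g. ?s g \<beta>)"
    by (simp flip: rpoly_sum_monomials)
  also have "\<dots> = (\<Sum>\<alpha>\<in>Poly_Mapping.keys f. \<Sum>\<beta>\<in>Poly_Mapping.keys g.
      Poly_Mapping.single (\<alpha> + \<beta>) (Poly_Mapping.lookup f \<alpha> * Poly_Mapping.lookup g \<beta>))"
    by (simp only: sum_product mult_single)
  finally show ?thesis
    by (simp add: riesz_sum riesz_single shift_seq_def sum_distrib_left mult.assoc)
qed

lemma riesz_square_nonneg:
  assumes psd: "psd_on (monoms_upto t) (moment_mat y)" and f: "Poly_Mapping.keys f \<subseteq> monoms_upto t"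
  shows "0 \<le> riesz y (f * f)"
proof -
  let ?A = "monoms_upto t" and ?c = "Poly_Mapping.lookup f"
  have "riesz y (f * f) = (\<Sum>\<alpha>\<in>?A. ?c \<alpha> * shift_seq f y \<alpha>)"
    unfolding riesz_mult using f finite_monoms_upto
    by (intro sum.mono_neutral_left) (auto simp: in_keys_iff)
  also have "\<dots> = (\<Sum>\<alpha>\<in>?A. \<Sum>\<beta>\<in>?A. ?c \<alpha> * moment_mat y \<alpha> \<beta> * ?c \<beta>)"
  proof (rule sum.cong)
    fix \<alpha>
    have "shift_seq f y \<alpha> = (\<Sum>\<beta>\<in>?A. ?c \<beta> * y (\<alpha> + \<beta>))"
      unfolding shift_seq_def using f finite_monoms_upto
      by (intro sum.mono_neutral_left) (auto simp: in_keys_iff)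
    then show "?c \<alpha> * shift_seq f y \<alpha> = (\<Sum>\<beta>\<in>?A. ?c \<alpha> * moment_mat y \<alpha> \<beta> * ?c \<beta>)"
      by (simp add: sum_distrib_left moment_mat_def ac_simps)
  qed simp
  also have "0 \<le> \<dots>" using psd by (simp add: psd_on_def)
  finally show ?thesis .
qed

lemma monom_deg_add: "monom_deg (\<alpha> + \<beta>) = monom_deg \<alpha> + monom_deg \<beta>"
  by (simp add: monom_deg_def lookup_add sum.distrib)

lemma monom_split:
  fixes \<alpha> :: "'n::finite monom"
  assumes "k \<le> monom_deg \<alpha>"
  shows "\<exists>\<beta> \<gamma>. \<alpha> = \<beta> + \<gamma> \<and> monom_deg \<beta> = k"
  using assms
proof (induction k)
  case 0
  show ?case by (intro exI[of _ 0] exI[of _ \<alpha>]) (simp add: monom_deg_def)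
next
  case (Suc k)
  then obtain \<beta> \<gamma> where *: "\<alpha> = \<beta> + \<gamma>" "monom_deg \<beta> = k" by auto
  have "monom_deg \<gamma> \<noteq> 0" using Suc.prems * by (simp add: monom_deg_add)
  then obtain i where i: "0 < Poly_Mapping.lookup \<gamma> i" by (auto simp: monom_deg_def)
  have "\<gamma> = Poly_Mapping.single i 1 + (\<gamma> - Poly_Mapping.single i 1)"
    using i by (intro poly_mapping_eqI) (auto simp: lookup_add lookup_minus lookup_single when_def)
  then have "\<alpha> = (\<beta> + Poly_Mapping.single i 1) + (\<gamma> - Poly_Mapping.single i 1)"
    using *(1) by (simp add: add.assoc)
  moreover have "monom_deg (\<beta> + Poly_Mapping.single i 1) = Suc k"
    using *(2) by (simp add: monom_deg_add) (simp add: monom_deg_def lookup_single when_def)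
  ultimately show ?case by blast
qed

lemma monoms_upto_double:
  assumes "\<alpha> \<in> monoms_upto (2 * s)"
  shows "\<exists>\<beta>\<in>monoms_upto s. \<exists>\<gamma>\<in>monoms_upto s. \<alpha> = \<beta> + \<gamma>"
proof -
  obtain \<beta> \<gamma> where *: "\<alpha> = \<beta> + \<gamma>" "monom_deg \<beta> = min s (monom_deg \<alpha>)"
    using monom_split[of "min s (monom_deg \<alpha>)" \<alpha>] by auto
  then have "monom_deg \<gamma> \<le> s" using assms by (auto simp: monom_deg_add monoms_upto_def)
  with * show ?thesis by (intro bexI[of _ \<beta>] bexI[of _ \<gamma>]) (auto simp: monoms_upto_def)
qed

text \<open>
  The matrix of order \<open>s\<close> contains the shifted sequence up to degree \<open>2 * s\<close>, because each exponent of degree at most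
  \<open>2 * s\<close> is a sum of two exponents of degree at most \<open>s\<close>.
\<close>

lemma riesz_ideal_zero:
  assumes zero: "zero_on (monoms_upto s) (moment_mat (shift_seq h y))" and q: "Poly_Mapping.keys q \<subseteq> monoms_upto (2 * s)"
  shows "riesz y (q * h) = 0"
proof -
  have "shift_seq h y \<alpha> = 0" if "\<alpha> \<in> monoms_upto (2 * s)" for \<alpha>
    using monoms_upto_double[OF that] zero by (auto simp: zero_on_def moment_mat_def)
  then show ?thesis unfolding riesz_mult using q by (intro sum.neutral) auto
qed

lemma eventually_keys_subset:
  fixes f :: "'n::finite rpoly"
  shows
  "eventually (\<lambda>t. Poly_Mapping.keys f \<subseteq> monoms_upto (2 * (t - k)) \<and> Poly_Mapping.keys f \<subseteq> monoms_upto t) sequentially"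
proof -
  let ?d = "total_deg f"
  have "Poly_Mapping.keys f \<subseteq> monoms_upto s" if "?d \<le> s" for s
    using that by (auto simp: total_deg_def monoms_upto_def)
  then show ?thesis
    by (intro eventually_mono[OF eventually_ge_at_top[of "?d + k"]]) auto
qed

lemma eventually_riesz_sos:
  assumes "s \<in> sos"
  shows "eventually (\<lambda>t. \<forall>y. psd_on (monoms_upto t) (moment_mat y) \<longrightarrow> 0 \<le> riesz y s) sequentially"
  using assms
proof induction
  case zero
  then show ?case by (simp add: riesz_0)
next
  case (add_square s f)
  from this(2) eventually_keys_subset[of f 0] show ?case
    by eventually_elim (auto simp: riesz_add intro!: add_nonneg_nonneg riesz_square_nonneg)
qed

lemma half_deg_le_max: "j \<in> {1..m} \<Longrightarrow> half_deg (h j) \<le> max_half_deg m h"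
  by (auto simp: max_half_deg_def intro!: Max_ge)

text \<open>
  For \<open>t\<close> beyond the degrees that occur in the certificate, an element \<open>y\<close> would give
  \<open>riesz y (1 + s) \<ge> 1\<close> by positivity and \<open>riesz y (1 + s) = 0\<close> by the localizing conditions.
\<close>

theorem moment_set_eventually_empty:
  assumes s: "s \<in> sos" and g: "1 + s \<in> gen_ideal m h"
  shows "\<exists>t\<ge>max_half_deg m h. moment_set m h t = {}"
proof -
  obtain q where q: "1 + s = (\<Sum>j=1..m. q j * h j)" using g by (auto simp: gen_ideal_def)
  have "eventually (\<lambda>t. \<forall>j\<in>{1..m}. Poly_Mapping.keys (q j) \<subseteq> monoms_upto (2 * (t - half_deg (h j)))) sequentially"
    by (intro eventually_ball_finite ballI eventually_mono[OF eventually_keys_subset]) auto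
  with eventually_riesz_sos[OF s] eventually_ge_at_top[of "max_half_deg m h"]
  have "eventually (\<lambda>t. max_half_deg m h \<le> t \<and> moment_set m h t = {}) sequentially"
  proof eventually_elim
    case (elim t)
    have False if "y \<in> moment_set m h t" for y
    proof -
      have y: "y 0 = 1" "psd_on (monoms_upto t) (moment_mat y)"
        "\<And>j. j \<in> {1..m} \<Longrightarrow> zero_on (monoms_upto (t - half_deg (h j))) (moment_mat (shift_seq (h j) y))"
        using that by (auto simp: moment_set_def)
      have "riesz y (1 + s) = (\<Sum>j=1..m. riesz y (q j * h j))" by (simp add: q riesz_sum)
      also have "\<dots> = 0" using y(3) elim(3) by (intro sum.neutral ballI riesz_ideal_zero) auto
      also have "riesz y (1 + s) = 1 + riesz y s"
        using riesz_single[of y 0 1] y(1) by (simp add: riesz_add)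
      finally show False using elim(1) y(2) by fastforce
    qed
    with elim(2) show ?case by blast
  qed
  then show ?thesis using eventually_happens'[OF sequentially_bot] by blast
qed

text \<open>
  The moments of the point mass at \<open>x\<close>: the moment matrix has rank one, and the localizing conditions
  multiply it by the values of the generators at \<open>x\<close>.
\<close>

lemma point_moment_sequence:
  fixes x :: "real ^ 'n"
  assumes x: "x \<in> real_variety (gen_ideal m h)" and t: "max_half_deg m h \<le> t"
  shows "moment_set m h t \<noteq> {}"
proof -
  define p where "p \<alpha> = (\<Prod>i\<in>UNIV. (x $ i) ^ Poly_Mapping.lookup \<alpha> i)" for \<alpha> :: "'n monom"
  have p_add: "p (\<alpha> + \<beta>) = p \<alpha> * p \<beta>" for \<alpha> \<beta>
    by (simp add: p_def lookup_add power_add prod.distrib)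
  define y where "y = restrict p (monoms_upto (2 * t))"
  have "y \<in> moment_set m h t"
    unfolding moment_set_def
  proof (intro CollectI conjI ballI)
    show "y \<in> monoms_upto (2 * t) \<rightarrow>\<^sub>E UNIV" by (simp add: y_def)
    show "y 0 = 1" by (simp add: y_def monoms_upto_def monom_deg_def p_def)
    show "psd_on (monoms_upto t) (moment_mat y)"
      unfolding psd_on_def
    proof (intro conjI ballI allI)
      fix \<alpha> \<beta> show "moment_mat y \<alpha> \<beta> = moment_mat y \<beta> \<alpha>" by (simp add: moment_mat_def add.commute)
    next
      fix v :: "'n monom \<Rightarrow> real"
      have "(\<Sum>a\<in>monoms_upto t. \<Sum>b\<in>monoms_upto t. v a * moment_mat y a b * v b)
          = (\<Sum>a\<in>monoms_upto t. \<Sum>b\<in>monoms_upto t. (v a * p a) * (v b * p b))"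
        by (intro sum.cong) (auto simp: moment_mat_def y_def p_add monoms_upto_def monom_deg_add)
      also have "\<dots> = (\<Sum>a\<in>monoms_upto t. v a * p a)\<^sup>2"
        by (simp add: power2_eq_square sum_product)
      finally show "0 \<le> (\<Sum>a\<in>monoms_upto t. \<Sum>b\<in>monoms_upto t. v a * moment_mat y a b * v b)" by simp
    qed
    fix j assume j: "j \<in> {1..m}"
    have deg: "monom_deg \<gamma> \<le> 2 * half_deg (h j)" if "\<gamma> \<in> Poly_Mapping.keys (h j)" for \<gamma>
    proof -
      have "monom_deg \<gamma> \<le> total_deg (h j)" using that by (auto simp: total_deg_def)
      moreover have "real (total_deg (h j)) \<le> 2 * real (half_deg (h j))"
        unfolding half_deg_def by linarith
      ultimately show ?thesis by linarith
    qed
    have half: "half_deg (h j) \<le> t" using half_deg_le_max[OF j] t by (rule order_trans)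
    show "zero_on (monoms_upto (t - half_deg (h j))) (moment_mat (shift_seq (h j) y))"
      unfolding zero_on_def
    proof (intro ballI)
      fix \<alpha> \<beta> :: "'n monom" assume ab: "\<alpha> \<in> monoms_upto (t - half_deg (h j))" "\<beta> \<in> monoms_upto (t - half_deg (h j))"
      have "moment_mat (shift_seq (h j) y) \<alpha> \<beta>
          = (\<Sum>\<gamma>\<in>Poly_Mapping.keys (h j). p (\<alpha> + \<beta>) * (Poly_Mapping.lookup (h j) \<gamma> * p \<gamma>))"
        unfolding moment_mat_def shift_seq_def
      proof (rule sum.cong)
        fix \<gamma> assume "\<gamma> \<in> Poly_Mapping.keys (h j)"
        then have "\<alpha> + \<beta> + \<gamma> \<in> monoms_upto (2 * t)"
          using deg[of \<gamma>] ab half by (simp add: monoms_upto_def monom_deg_add)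
        then show "Poly_Mapping.lookup (h j) \<gamma> * y (\<alpha> + \<beta> + \<gamma>) = p (\<alpha> + \<beta>) * (Poly_Mapping.lookup (h j) \<gamma> * p \<gamma>)"
          by (simp add: y_def p_add)
      qed simp
      also have "\<dots> = p (\<alpha> + \<beta>) * poly_eval (h j) x"
        by (simp add: poly_eval_def p_def sum_distrib_left)
      also have "\<dots> = 0" using x j by (simp add: real_variety_gen_ideal)
      finally show "moment_mat (shift_seq (h j) y) \<alpha> \<beta> = 0" .
    qed
  qed
  then show ?thesis by blast
qed

theorem mainTheorem5:
  fixes m :: nat and h :: "nat \<Rightarrow> 'n::finite rpoly"
  shows "real_variety (gen_ideal m h) = {} \<longleftrightarrow>
    (\<exists>t\<ge>max_half_deg m h. moment_set m h t = {})"
proof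
  assume "real_variety (gen_ideal m h) = {}"
  then show "\<exists>t\<ge>max_half_deg m h. moment_set m h t = {}"
    using real_nullstellensatz moment_set_eventually_empty by blast
next
  assume "\<exists>t\<ge>max_half_deg m h. moment_set m h t = {}"
  then show "real_variety (gen_ideal m h) = {}"
    using point_moment_sequence by blast
qed

end
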